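(* Let $h(x)\in\mathbb{F}_q(x)$ be a rational function of degree $r+1$ such that the extension $\mathbb{F}_q(x)/\mathbb{F}_q(t)$ is Galois, where $t=h(x)$, with Galois group $G_h$. Let $V_s$ denote the number of short orbits of the natural action of $G_h$ on the set of rational places of $\mathbb{F}_q(x)$. Then $$\#T^1_{split}(h)=\begin{cases}\dfrac{q+1}{r+1}, & \text{if } V_s=0,\\[2ex] \left\lceil\dfrac{q+1}{r+1}\right\rceil-1, & \text{if } V_s=1,2,\\[2ex] \left\lceil\dfrac{q+1}{r+1}\right\rceil-2, & \text{if } V_s=3.\end{cases}$$
   Context: $q$ is a prime power. For $h=f/g$ with $f,g\in\mathbb{F}_q[x]$ coprime, $\deg(h)=\max\{\deg f,\deg g\}=[\mathbb{F}_q(x):\mathbb{F}_q(t)]$. $T^1_{split}(h)$ is the set of rational (degree-one) places of $\mathbb{F}_q(t)$ that split totally in $\mathbb{F}_q(x)/\mathbb{F}_q(t)$, i.e. over which there lie exactly $\deg(h)$ places of $\mathbb{F}_q(x)$. An orbit of $G_h$ on the set of the $q+1$ rational places of $\mathbb{F}_q(x)$ is long if its size is $\#G_h=\deg(h)$, and short otherwise. (It is a fact that $V_s\le 3$.) *)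

theory Defs
  imports
    Complex_Main
    "HOL-Library.Cardinality"
    "HOL-Library.FuncSet"
    "HOL-Computational_Algebra.Polynomial"
    "HOL-Computational_Algebra.Fraction_Field"
    "HOL-Algebra.Group_Action"
begin

text \<open>Subrings and subfields of a field type, as sets.\<close>

definition is_subring :: "'b::field set \<Rightarrow> bool" where
  "is_subring R \<longleftrightarrow> 1 \<in> R \<and> (\<forall>x\<in>R. \<forall>y\<in>R. x - y \<in> R \<and> x * y \<in> R)"

definition is_subfield :: "'b::field set \<Rightarrow> bool" where
  "is_subfield K \<longleftrightarrow> is_subring K \<and> (\<forall>x\<in>K. inverse x \<in> K)"

definition field_adjoin :: "'b::field set \<Rightarrow> 'b \<Rightarrow> 'b set" where
  "field_adjoin k t = \<Inter>{K. is_subfield K \<and> insert t k \<subseteq> K}"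


text \<open>The extension \<open>L/K\<close>, where \<open>L\<close> is the whole field type \<open>'b\<close> and
  \<open>K\<close> is a subfield of it.\<close>

definition field_auts :: "'b::field set \<Rightarrow> ('b \<Rightarrow> 'b) set" where
  "field_auts K = {\<sigma>. bij \<sigma> \<and> (\<forall>x y. \<sigma> (x + y) = \<sigma> x + \<sigma> y) \<and>
     (\<forall>x y. \<sigma> (x * y) = \<sigma> x * \<sigma> y) \<and> (\<forall>x\<in>K. \<sigma> x = x)}"

definition galois_group :: "'b::field set \<Rightarrow> ('b \<Rightarrow> 'b) monoid" where
  "galois_group K = \<lparr>carrier = field_auts K, mult = (\<circ>), one = id\<rparr>"

definition algebraic_extension :: "'b::field set \<Rightarrow> bool" where
  "algebraic_extension K \<longleftrightarrow>
     (\<forall>z. \<exists>p::'b poly. p \<noteq> 0 \<and> (\<forall>i. coeff p i \<in> K) \<and> poly p z = 0)"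

definition galois_extension :: "'b::field set \<Rightarrow> bool" where
  "galois_extension K \<longleftrightarrow> is_subfield K \<and> algebraic_extension K \<and>
     {z. \<forall>\<sigma>\<in>field_auts K. \<sigma> z = z} = K"


text \<open>Places of a function field \<open>E/k\<close>, both \<open>k\<close> and \<open>E\<close> being subfields
  of a field type. A place is the maximal ideal of a valuation ring of \<open>E/k\<close>.\<close>

definition valuation_ring :: "'b::field set \<Rightarrow> 'b set \<Rightarrow> 'b set \<Rightarrow> bool" where
  "valuation_ring k E R \<longleftrightarrow> is_subring R \<and> k \<subset> R \<and> R \<subset> E \<and>
     (\<forall>z\<in>E. z \<noteq> 0 \<longrightarrow> z \<in> R \<or> inverse z \<in> R)"

text \<open>A valuation ring is local, and its maximal ideal consists of its non-units.\<close>

definition nonunits :: "'b::field set \<Rightarrow> 'b set" where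
  "nonunits R = {z \<in> R. z = 0 \<or> inverse z \<notin> R}"

definition places :: "'b::field set \<Rightarrow> 'b set \<Rightarrow> 'b set set" where
  "places k E = {nonunits R | R. valuation_ring k E R}"

text \<open>The place determines its valuation ring. The case \<open>z = 0\<close> is separate
  because \<open>inverse 0 = 0\<close> lies in every place.\<close>

definition place_ring :: "'b::field set \<Rightarrow> 'b set \<Rightarrow> 'b set" where
  "place_ring E P = {z \<in> E. z = 0 \<or> inverse z \<notin> P}"

text \<open>The degree of \<open>P\<close> is the dimension over \<open>k\<close> of the residue field, i.e. of
  \<open>place_ring E P\<close> modulo \<open>P\<close>; the set \<open>B\<close> represents a basis.\<close>

definition has_place_degree ::
    "'b::field set \<Rightarrow> 'b set \<Rightarrow> 'b set \<Rightarrow> nat \<Rightarrow> bool" where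
  "has_place_degree k E P n \<longleftrightarrow>
     (\<exists>B. finite B \<and> card B = n \<and> B \<subseteq> place_ring E P \<and>
       (\<forall>z\<in>place_ring E P. \<exists>!c. c \<in> B \<rightarrow>\<^sub>E k \<and> z - (\<Sum>b\<in>B. c b * b) \<in> P))"

definition rational_places :: "'b::field set \<Rightarrow> 'b set \<Rightarrow> 'b set set" where
  "rational_places k E = {P \<in> places k E. has_place_degree k E P 1}"

definition places_above :: "'b::field set \<Rightarrow> 'b set \<Rightarrow> 'b set \<Rightarrow> 'b set set" where
  "places_above k L P = {Q \<in> places k L. P \<subseteq> Q}"


text \<open>The rational function field \<open>F\<^sub>q(x)\<close> is the type \<^typ>\<open>'a poly fract\<close> with
  \<^typ>\<open>'a\<close> a finite field.\<close>

definition constants :: "'a::field poly fract set" where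
  "constants = range (\<lambda>c. Fract [:c:] 1)"

definition rf_degree :: "'a::field poly fract \<Rightarrow> nat" where
  "rf_degree h = (THE n. \<exists>f g. g \<noteq> 0 \<and> coprime f g \<and> h = Fract f g \<and>
     n = max (degree f) (degree g))"

text \<open>The subfield \<open>F\<^sub>q(t)\<close> of \<open>F\<^sub>q(x)\<close>, where \<open>t = h(x)\<close>.\<close>

definition Fq_t :: "'a::field poly fract \<Rightarrow> 'a poly fract set" where
  "Fq_t h = field_adjoin constants h"

definition T1_split :: "'a::field poly fract \<Rightarrow> 'a poly fract set set" where
  "T1_split h = {P \<in> rational_places constants (Fq_t h).
     card (places_above constants UNIV P) = rf_degree h}"

definition G_h :: "'a::field poly fract \<Rightarrow> ('a poly fract \<Rightarrow> 'a poly fract) monoid" where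
  "G_h h = galois_group (Fq_t h)"

definition place_orbits :: "'a::field poly fract \<Rightarrow> 'a poly fract set set set" where
  "place_orbits h = orbits (G_h h) (rational_places constants UNIV) (\<lambda>\<sigma> P. \<sigma> ` P)"

definition short_orbits :: "'a::field poly fract \<Rightarrow> 'a poly fract set set set" where
  "short_orbits h = {X \<in> place_orbits h. card X \<noteq> order (G_h h)}"

definition V_s :: "'a::field poly fract \<Rightarrow> nat" where
  "V_s h = card (short_orbits h)"


text \<open>Every rational function has a coprime representation, and \<^const>\<open>rf_degree\<close>
  does not depend on its choice.\<close>

lemma poly_bezout:
  fixes f g :: "'a::field poly"
  assumes "g \<noteq> 0"
  obtains a b d where "d = a * f + b * g" "d \<noteq> 0" "d dvd f" "d dvd g"
proof -
  define I where "I = {d. d \<noteq> 0 \<and> (\<exists>a b. d = a * f + b * g)}"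
  have "g = 0 * f + 1 * g" by simp
  then have "g \<in> I" unfolding I_def using assms by blast
  then obtain d where d: "d \<in> I" and least: "\<And>e. e \<in> I \<Longrightarrow> degree d \<le> degree e"
    using arg_min_nat_lemma[of "\<lambda>d. d \<in> I" g degree] by blast
  from d obtain a b where ab: "d = a * f + b * g" and "d \<noteq> 0"
    unfolding I_def by blast
  have "d dvd u * f + v * g" for u v
  proof (rule ccontr)
    let ?w = "u * f + v * g"
    assume "\<not> d dvd ?w"
    then have nz: "?w mod d \<noteq> 0" by (simp add: dvd_eq_mod_eq_0)
    have "?w mod d = ?w - ?w div d * d"
      by (simp add: minus_div_mult_eq_mod)
    also have "\<dots> = ?w - ?w div d * (a * f + b * g)"
      by (simp only: ab[symmetric])
    also have "\<dots> = (u - ?w div d * a) * f + (v - ?w div d * b) * g"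
      by (simp add: algebra_simps)
    finally have "?w mod d \<in> I" unfolding I_def using nz by blast
    then have "degree d \<le> degree (?w mod d)" by (rule least)
    moreover have "degree (?w mod d) < degree d"
      using nz degree_mod_less[OF \<open>d \<noteq> 0\<close>, of ?w] by simp
    ultimately show False by simp
  qed
  from this[of 1 0] this[of 0 1] have "d dvd f" "d dvd g" by simp_all
  then show thesis using that ab \<open>d \<noteq> 0\<close> by blast
qed

lemma coprime_representation:
  fixes h :: "'a::field poly fract"
  obtains f g where "g \<noteq> 0" "coprime f g" "h = Fract f g"
proof -
  obtain f g where h: "h = Fract f g" "g \<noteq> 0" by (cases h) auto
  obtain a b d where d: "d = a * f + b * g" "d \<noteq> 0" "d dvd f" "d dvd g"
    using poly_bezout[OF \<open>g \<noteq> 0\<close>] .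
  obtain f' g' where f': "f = d * f'" and g': "g = d * g'"
    using d(3,4) unfolding dvd_def by blast
  have "d * 1 = d * (a * f' + b * g')"
    using d(1) unfolding f' g' by (simp add: algebra_simps)
  then have one: "1 = a * f' + b * g'" using \<open>d \<noteq> 0\<close> by (metis mult_cancel_left)
  have "coprime f' g'"
  proof (rule coprimeI)
    fix c assume "c dvd f'" "c dvd g'"
    then have "c dvd a * f' + b * g'" by simp
    then show "is_unit c" by (simp only: one[symmetric])
  qed
  moreover have "g' \<noteq> 0" using h(2) g' by auto
  moreover have "h = Fract f' g'"
    unfolding h(1) f' g' using \<open>d \<noteq> 0\<close> \<open>g' \<noteq> 0\<close> by (simp add: eq_fract)
  ultimately show thesis using that by blast
qed

lemma coprime_poly_dvd:
  fixes f g u :: "'a::field poly"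
  assumes "g \<noteq> 0" "coprime f g" "g dvd f * u"
  shows "g dvd u"
proof -
  obtain a b d where d: "d = a * f + b * g" "d \<noteq> 0" "d dvd f" "d dvd g"
    using poly_bezout[OF \<open>g \<noteq> 0\<close>] .
  have "is_unit d" using assms(2) d(3,4) by (rule coprime_common_divisor)
  have "d * u = a * (f * u) + b * u * g"
    unfolding d(1) by (simp add: algebra_simps)
  then have "g dvd d * u" using assms(3) by simp
  then show ?thesis using \<open>is_unit d\<close> by (simp add: dvd_mult_unit_iff')
qed

lemma rf_degree_Fract:
  fixes f g :: "'a::field poly"
  assumes "g \<noteq> 0" "coprime f g"
  shows "rf_degree (Fract f g) = max (degree f) (degree g)"
  unfolding rf_degree_def
proof (rule the_equality)
  show "\<exists>f' g'. g' \<noteq> 0 \<and> coprime f' g' \<and> Fract f g = Fract f' g' \<and>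
      max (degree f) (degree g) = max (degree f') (degree g')"
    using assms by blast
next
  fix n
  assume "\<exists>f' g'. g' \<noteq> 0 \<and> coprime f' g' \<and> Fract f g = Fract f' g' \<and>
      n = max (degree f') (degree g')"
  then obtain f' g' where *: "g' \<noteq> 0" "coprime f' g'" "Fract f g = Fract f' g'"
      "n = max (degree f') (degree g')"
    by blast
  have eq: "f * g' = f' * g"
    using * assms by (simp add: eq_fract)
  have "g dvd g'"
    by (rule coprime_poly_dvd[OF assms]) (simp add: eq)
  moreover have "g' dvd g"
    by (rule coprime_poly_dvd[OF *(1,2)]) (simp add: eq[symmetric])
  ultimately have dg: "degree g = degree g'"
    using *(1) assms(1) by (intro antisym dvd_imp_degree_le)
  have "degree f = degree f'"
  proof (cases "f = 0")
    case True
    then have "f' = 0" using eq assms(1) by simp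
    then show ?thesis using True by simp
  next
    case False
    then have "f' \<noteq> 0" using eq *(1) by auto
    have "degree f + degree g' = degree f' + degree g"
      using arg_cong[OF eq, of degree] False \<open>f' \<noteq> 0\<close> *(1) assms(1)
      by (simp add: degree_mult_eq)
    then show ?thesis using dg by simp
  qed
  then show "n = max (degree f) (degree g)"
    using dg *(4) by simp
qed

end

theory Submission imports Defs begin

text \<open>
  Let \<open>n = deg h = r + 1\<close> and \<open>K = F\<^sub>q(t)\<close>. Since \<open>x\<close> has degree \<open>n\<close> over \<open>K\<close>, the group \<open>G\<^sub>h\<close> has
  order \<open>n\<close>. At most \<open>n\<close> places lie above a rational place of \<open>K\<close>, and if there are exactly \<open>n\<close>
  they are all rational; as \<open>G\<^sub>h\<close> permutes the rational places above a place transitively, the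
  totally split rational places correspond to the long orbits. If there are \<open>L\<close> of them and
  the short orbits have \<open>S\<close> elements in total, then \<open>q + 1 = nL + S\<close>. A short orbit has at most
  \<open>n/2\<close> elements, which settles the cases \<open>V\<^sub>s \<le> 2\<close>. For \<open>V\<^sub>s = 3\<close> one also needs \<open>S > n\<close>: a
  non-identity element of \<open>G\<^sub>h\<close> is a Moebius transformation and fixes at most two rational
  places, so Burnside's lemma gives \<open>n(L + V\<^sub>s) \<le> q + 1 + 2(n - 1)\<close>, that is
  \<open>S \<ge> nV\<^sub>s - 2n + 2\<close>.
\<close>

section \<open>Subfields, evaluation and automorphisms\<close>

text \<open>The order of the Galois group and the number of places above P are both counted through
  polynomials. \<open>card G \<le> n\<close> because an automorphism is determined by the image of
  x, which is a root of f(Y) - h g(Y). \<open>n \<le> card G\<close> because the product of the Y -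
  \<tau>(x) has coefficients in K, and no nonzero polynomial over K of degree below n vanishes at x.
  For places, factorisation does the work of the fundamental identity. A rational P contains h - a
  or 1/h, a function F/G of degree n, so the places above P are among the zeros of F/G. Zeros at
  which x is integral belong to distinct prime factors of F. The place at infinity is a zero only if
  F has degree below n, so it uses up the missing degree. Having n zeros forces all these prime
  factors to be linear, hence the places to be rational. With three short orbits, S \<le> 3n/2 alone
  leaves open whether the ceiling is L + 1 or L + 2; the fixed-point count gives S \<ge> n + 2 and
  decides for L + 2.\<close>

lemma is_subring_closed:
  assumes "is_subring R"
  shows "0 \<in> R" "1 \<in> R"
    "\<And>x y. x \<in> R \<Longrightarrow> y \<in> R \<Longrightarrow> x - y \<in> R"
    "\<And>x y. x \<in> R \<Longrightarrow> y \<in> R \<Longrightarrow> x + y \<in> R"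
    "\<And>x y. x \<in> R \<Longrightarrow> y \<in> R \<Longrightarrow> x * y \<in> R"
    "\<And>x. x \<in> R \<Longrightarrow> - x \<in> R"
    "\<And>x n. x \<in> R \<Longrightarrow> x ^ n \<in> R"
proof -
  show one: "1 \<in> R" and diff: "\<And>x y. x \<in> R \<Longrightarrow> y \<in> R \<Longrightarrow> x - y \<in> R"
    and mult: "\<And>x y. x \<in> R \<Longrightarrow> y \<in> R \<Longrightarrow> x * y \<in> R"
    using assms unfolding is_subring_def by auto
  from diff[OF one one] show zero: "0 \<in> R" by simp
  from diff[OF zero] show minus: "\<And>x. x \<in> R \<Longrightarrow> - x \<in> R" by simp
  show "x + y \<in> R" if "x \<in> R" "y \<in> R" for x y
    using diff[OF that(1) minus[OF that(2)]] by simp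
  show "x ^ n \<in> R" if "x \<in> R" for x n
    using that by (induction n) (auto intro: one mult)
qed

lemma is_subfield_closed:
  assumes "is_subfield K"
  shows "is_subring K" "\<And>x. x \<in> K \<Longrightarrow> inverse x \<in> K"
    "\<And>x y. x \<in> K \<Longrightarrow> y \<in> K \<Longrightarrow> x / y \<in> K"
  using assms is_subring_closed(5) unfolding is_subfield_def divide_inverse by blast+

lemma is_subfield_UNIV: "is_subfield UNIV"
  by (simp add: is_subfield_def is_subring_def)

lemma field_adjoin_least:
  "is_subfield K \<Longrightarrow> k \<subseteq> K \<Longrightarrow> t \<in> K \<Longrightarrow> field_adjoin k t \<subseteq> K"
  unfolding field_adjoin_def by blast

lemma field_adjoin_subfield: "is_subfield (field_adjoin k t)"
  unfolding field_adjoin_def is_subfield_def is_subring_def by blast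

lemma field_adjoin_base: "k \<subseteq> field_adjoin k t" "t \<in> field_adjoin k t"
  unfolding field_adjoin_def by blast+

section \<open>Polynomials inside F_q(x) and substitution of rational functions\<close>

definition emb :: "'a::field poly \<Rightarrow> 'a poly fract" where
  "emb p = Fract p 1"

definition cst :: "'a::field \<Rightarrow> 'a poly fract" where
  "cst c = emb [:c:]"

definition indet :: "'a::field poly fract" where
  "indet = emb [:0, 1:]"

lemma constants_eq: "constants = range cst"
  by (simp add: constants_def cst_def emb_def)

lemma emb_simps [simp]:
  "emb 0 = 0" "emb 1 = 1" "emb (p + q) = emb p + emb q" "emb (p - q) = emb p - emb q"
  "emb (p * q) = emb p * emb q" "emb (- p) = - emb p"
  "emb p = emb q \<longleftrightarrow> p = q"
  by (auto simp: emb_def Zero_fract_def One_fract_def eq_fract)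

lemma emb_eq_0_iff [simp]: "emb p = 0 \<longleftrightarrow> p = 0"
  using emb_simps(7)[of p 0] by (simp del: emb_simps(7))

lemma emb_power [simp]: "emb (p ^ n) = emb p ^ n"
  by (induction n) simp_all

lemma emb_sum: "emb (sum f A) = (\<Sum>i\<in>A. emb (f i))"
  by (induction A rule: infinite_finite_induct) simp_all

lemma Fract_emb: "q \<noteq> 0 \<Longrightarrow> Fract p q = emb p / emb q"
  by (simp add: emb_def divide_fract)

lemma cst_simps [simp]:
  "cst 0 = 0" "cst 1 = 1" "cst (a + b) = cst a + cst b" "cst (a - b) = cst a - cst b"
  "cst (a * b) = cst a * cst b" "cst (- a) = - cst a" "cst a = cst b \<longleftrightarrow> a = b"
  unfolding cst_def
  by (simp_all flip: emb_simps(2,3,4,5,6) add: one_pCons)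

lemma cst_eq_0_iff [simp]: "cst c = 0 \<longleftrightarrow> c = 0"
  by (simp add: cst_def)

lemma inverse_cst: "inverse (cst c) = cst (inverse c)"
proof (cases "c = 0")
  case False
  then have "cst c * cst (inverse c) = 1"
    by (simp flip: cst_simps(5))
  then show ?thesis using inverse_unique by blast
qed simp

lemma is_subfield_constants: "is_subfield constants"
  unfolding is_subfield_def is_subring_def constants_eq
  by (auto simp: inverse_cst simp flip: cst_simps(2,4,5))

definition ev :: "'a::field poly \<Rightarrow> 'a poly fract \<Rightarrow> 'a poly fract" where
  "ev p y = poly (map_poly cst p) y"

lemma ev_0 [simp]: "ev 0 y = 0"
  by (simp add: ev_def)

lemma ev_pCons [simp]: "ev (pCons c p) y = cst c + y * ev p y"
  by (simp add: ev_def map_poly_pCons)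

lemma ev_1 [simp]: "ev 1 y = 1"
  by (simp add: one_pCons)

lemma ev_add [simp]: "ev (p + q) y = ev p y + ev q y"
  by (induction p q rule: poly_induct2) (simp_all add: algebra_simps)

lemma ev_smult [simp]: "ev (smult c p) y = cst c * ev p y"
  by (induction p) (simp_all add: algebra_simps)

lemma ev_minus [simp]: "ev (- p) y = - ev p y"
  by (induction p) (simp_all add: algebra_simps)

lemma ev_diff [simp]: "ev (p - q) y = ev p y - ev q y"
  using ev_add[of p "- q"] by simp

lemma ev_mult [simp]: "ev (p * q) y = ev p y * ev q y"
  by (induction p) (simp_all add: algebra_simps)

lemma ev_indet [simp]: "ev p indet = emb p"
proof (induction p)
  case (pCons c p)
  have "emb (pCons c p) = emb ([:c:] + [:0, 1:] * p)" by simp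
  then show ?case using pCons by (simp only: emb_simps cst_def indet_def ev_pCons)
qed simp

lemma ev_altdef: "ev p y = (\<Sum>j\<le>degree p. cst (coeff p j) * y ^ j)"
  by (simp add: ev_def poly_altdef coeff_map_poly degree_map_poly)

lemma ev_altdef_le: "degree p \<le> D \<Longrightarrow> ev p y = (\<Sum>j\<le>D. cst (coeff p j) * y ^ j)"
  unfolding ev_altdef
  by (rule sum.mono_neutral_left) (auto simp: coeff_eq_0 not_le)

lemma ev_in_subfield:
  assumes "is_subring K" "constants \<subseteq> K" "y \<in> K"
  shows "ev p y \<in> K"
  using assms
  by (induction p) (auto simp: constants_eq intro!: is_subring_closed)

text \<open>The intersection that defines F_q(y) gives no hold on single elements. As quotients of
  polynomials in y they can be cleared of denominators, which the degree argument relies on.\<close>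

lemma field_adjoin_fractions:
  "field_adjoin constants y = {ev p y / ev q y | p q. ev q y \<noteq> 0}" (is "_ = ?F")
proof
  have diff: "ev p y / ev q y - ev p' y / ev q' y = ev (p * q' - p' * q) y / ev (q * q') y"
    and mult: "ev p y / ev q y * (ev p' y / ev q' y) = ev (p * p') y / ev (q * q') y"
    and nz: "ev (q * q') y \<noteq> 0"
    if "ev q y \<noteq> 0" "ev q' y \<noteq> 0" for p q p' q'
    using that by (simp_all add: field_simps)
  have "1 = ev 1 y / ev 1 y" "ev 1 y \<noteq> 0" by simp_all
  then have "1 \<in> ?F" by blast
  moreover have "u - v \<in> ?F \<and> u * v \<in> ?F" if "u \<in> ?F" "v \<in> ?F" for u v
  proof -
    obtain p q where u: "u = ev p y / ev q y" "ev q y \<noteq> 0" using \<open>u \<in> ?F\<close> by blast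
    obtain p' q' where v: "v = ev p' y / ev q' y" "ev q' y \<noteq> 0" using \<open>v \<in> ?F\<close> by blast
    show ?thesis unfolding u(1) v(1) diff[OF u(2) v(2)] mult[OF u(2) v(2)]
      using nz[OF u(2) v(2)] by blast
  qed
  ultimately have "is_subring ?F" unfolding is_subring_def by blast
  moreover have "inverse z \<in> ?F" if z: "z \<in> ?F" for z
  proof (cases "z = 0")
    case True
    then show ?thesis using z by simp
  next
    case False
    then obtain p q where "z = ev p y / ev q y" "ev q y \<noteq> 0" "ev p y \<noteq> 0"
      using z by auto
    then have "inverse z = ev q y / ev p y" by simp
    then show ?thesis using \<open>ev p y \<noteq> 0\<close> by blast
  qed
  ultimately have "is_subfield ?F" by (simp add: is_subfield_def)
  moreover have "constants \<subseteq> ?F"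
  proof
    fix z :: "'a poly fract" assume "z \<in> constants"
    then obtain c where "z = ev [:c:] y / ev 1 y" by (auto simp: constants_eq)
    moreover have "ev 1 y \<noteq> 0" by simp
    ultimately show "z \<in> ?F" by blast
  qed
  moreover have "y \<in> ?F"
  proof -
    have "y = ev [:0, 1:] y / ev 1 y" "ev 1 y \<noteq> 0" by simp_all
    then show ?thesis by blast
  qed
  ultimately show "field_adjoin constants y \<subseteq> ?F" by (rule field_adjoin_least)
  have "ev p y \<in> field_adjoin constants y" for p
    by (intro ev_in_subfield is_subfield_closed field_adjoin_subfield field_adjoin_base)
  then show "?F \<subseteq> field_adjoin constants y"
    using is_subfield_closed(3)[OF field_adjoin_subfield] by blast
qed

section \<open>Automorphisms fixing a subfield\<close>

lemma field_autsD:
  assumes "\<sigma> \<in> field_auts K"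
  shows "bij \<sigma>" "\<sigma> (x + y) = \<sigma> x + \<sigma> y" "\<sigma> (x * y) = \<sigma> x * \<sigma> y" "z \<in> K \<Longrightarrow> \<sigma> z = z"
  using assms by (auto simp: field_auts_def)

lemma field_auts_hom:
  assumes "\<sigma> \<in> field_auts K"
  shows "\<sigma> 0 = 0" "\<sigma> 1 = 1" "\<sigma> (- x) = - \<sigma> x" "\<sigma> (x - y) = \<sigma> x - \<sigma> y"
    "\<sigma> (inverse x) = inverse (\<sigma> x)" "\<sigma> (x / y) = \<sigma> x / \<sigma> y"
    "\<sigma> x = 0 \<longleftrightarrow> x = 0"
proof -
  note hom = field_autsD[OF assms]
  have inj: "\<sigma> x = \<sigma> y \<longleftrightarrow> x = y" for x y using hom(1) by (simp add: bij_is_inj inj_eq)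
  have "\<sigma> 0 + \<sigma> 0 = \<sigma> 0" using hom(2)[of 0 0] by (simp only: add_0)
  then show zero: "\<sigma> 0 = 0" by (simp only: add_cancel_left_left)
  show eq0: "\<sigma> x = 0 \<longleftrightarrow> x = 0" for x using inj[of x 0] zero by simp
  show one: "\<sigma> 1 = 1" using hom(3)[of 1 1] eq0[of 1] by simp
  show minus: "\<sigma> (- x) = - \<sigma> x" for x
    using hom(2)[of x "- x"] zero by (simp add: eq_neg_iff_add_eq_0 add.commute)
  show "\<sigma> (x - y) = \<sigma> x - \<sigma> y" for x y
    using hom(2)[of x "- y"] minus by simp
  show inverse: "\<sigma> (inverse x) = inverse (\<sigma> x)" for x
  proof (cases "x = 0")
    case False
    then have "\<sigma> x * \<sigma> (inverse x) = 1" using hom(3)[of x "inverse x"] one by simp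
    then show ?thesis using inverse_unique by metis
  qed (simp add: zero)
  show "\<sigma> (x / y) = \<sigma> x / \<sigma> y" for x y
    by (simp add: divide_inverse hom(3) inverse)
qed

lemma field_auts_ev:
  assumes "\<sigma> \<in> field_auts K" "constants \<subseteq> K"
  shows "\<sigma> (ev p y) = ev p (\<sigma> y)"
proof (induction p)
  case (pCons c p)
  have "\<sigma> (cst c) = cst c"
    using assms field_autsD(4) by (metis constants_eq rangeI subsetD)
  then show ?case using pCons by (simp add: field_autsD[OF assms(1)])
qed (simp add: field_auts_hom[OF assms(1)])

text \<open>Every element is a quotient of values \<open>ev _ indet\<close>: x generates the field
  over the constants, so its image determines the automorphism.\<close>

lemma field_auts_eqI:
  assumes "\<sigma> \<in> field_auts K" "\<tau> \<in> field_auts K" "constants \<subseteq> K" "\<sigma> indet = \<tau> indet"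
  shows "\<sigma> = \<tau>"
proof
  fix z :: "'a poly fract"
  obtain f g where "g \<noteq> 0" "z = Fract f g" by (cases z) auto
  then have z: "z = ev f indet / ev g indet" by (simp add: Fract_emb)
  show "\<sigma> z = \<tau> z"
    unfolding z field_auts_hom(6)[OF assms(1)] field_auts_hom(6)[OF assms(2)]
      field_auts_ev[OF assms(1,3)] field_auts_ev[OF assms(2,3)] assms(4) ..
qed

lemma field_auts_id: "id \<in> field_auts K"
  by (simp add: field_auts_def)

lemma field_auts_comp: "\<sigma> \<in> field_auts K \<Longrightarrow> \<tau> \<in> field_auts K \<Longrightarrow> \<sigma> \<circ> \<tau> \<in> field_auts K"
  by (auto simp: field_auts_def intro: bij_comp)

lemma field_auts_inv:
  assumes "\<sigma> \<in> field_auts K"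
  shows "inv_into UNIV \<sigma> \<in> field_auts K" "\<sigma> (inv_into UNIV \<sigma> x) = x" "inv_into UNIV \<sigma> (\<sigma> x) = x"
proof -
  note hom = field_autsD[OF assms]
  show 1: "\<sigma> (inv_into UNIV \<sigma> x) = x" "inv_into UNIV \<sigma> (\<sigma> x) = x" for x
    using hom(1) by (simp_all add: bij_is_surj surj_f_inv_f bij_is_inj)
  have "inv_into UNIV \<sigma> (x + y) = inv_into UNIV \<sigma> x + inv_into UNIV \<sigma> y" "inv_into UNIV \<sigma> (x * y) = inv_into UNIV \<sigma> x * inv_into UNIV \<sigma> y" for x y
    using 1 hom(2,3) by metis+
  moreover have "\<forall>z\<in>K. inv_into UNIV \<sigma> z = z" using 1 hom(4) by metis
  ultimately show "inv_into UNIV \<sigma> \<in> field_auts K"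
    using hom(1) by (simp add: field_auts_def bij_imp_bij_inv)
qed

lemma group_galois_group: "group (galois_group K)"
proof (rule groupI)
  fix \<sigma> assume "\<sigma> \<in> carrier (galois_group K)"
  then have "\<sigma> \<in> field_auts K" by (simp add: galois_group_def)
  then show "\<exists>\<tau>\<in>carrier (galois_group K). \<tau> \<otimes>\<^bsub>galois_group K\<^esub> \<sigma> = \<one>\<^bsub>galois_group K\<^esub>"
    using field_auts_inv by (auto simp: galois_group_def fun_eq_iff intro!: bexI[of _ "inv_into UNIV \<sigma>"])
qed (auto simp: galois_group_def field_auts_id field_auts_comp)

section \<open>The degree of a rational function\<close>

lemma coprime_poly_dvd_power:
  fixes f g u :: "'a::field poly"
  assumes "g \<noteq> 0" "coprime f g" "g dvd u * f ^ m"
  shows "g dvd u"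
  using assms(3)
proof (induction m)
  case (Suc m)
  then have "g dvd f * (u * f ^ m)" by (simp add: mult_ac)
  then show ?case using coprime_poly_dvd[OF assms(1,2)] Suc.IH by blast
qed simp

text \<open>The elements \<open>x\<^sup>i t\<^sup>j\<close> with \<open>i < deg t\<close> and \<open>t = f/g\<close>, cleared of denominators,
  are linearly independent: one of \<open>f\<close>, \<open>g\<close> has degree \<open>deg t\<close> and divides the coefficient
  at an end of the relation.\<close>

lemma homogeneous_relation_trivial:
  fixes f g :: "'a::field poly"
  assumes fg: "coprime f g" and n: "n = max (degree f) (degree g)" "0 < n"
    and deg: "\<And>j. j \<le> D \<Longrightarrow> degree (c j) < n"
    and rel: "(\<Sum>j\<le>D. c j * (f ^ j * g ^ (D - j))) = 0"
    and "j \<le> D"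
  shows "c j = 0"
  using deg rel \<open>j \<le> D\<close>
proof (induction D arbitrary: c j)
  case 0
  then show ?case by simp
next
  case (Suc D)
  have less: "u = 0" if "w dvd u" "degree w = n" "degree u < n" for u w :: "'a poly"
    using that dvd_imp_degree_le by force
  consider "degree f = n" | "degree g = n" using n by linarith
  then show ?case
  proof cases
    case 1
    then have "f \<noteq> 0" using n by auto
    have "(\<Sum>j\<le>Suc D. c j * (f ^ j * g ^ (Suc D - j))) =
        c 0 * g ^ Suc D + (\<Sum>j\<le>D. c (Suc j) * (f ^ Suc j * g ^ (D - j)))"
      by (subst sum.atMost_Suc_shift) simp
    also have "(\<Sum>j\<le>D. c (Suc j) * (f ^ Suc j * g ^ (D - j))) =
        f * (\<Sum>j\<le>D. c (Suc j) * (f ^ j * g ^ (D - j)))"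
      unfolding sum_distrib_left by (intro sum.cong refl) (simp only: power_Suc mult_ac)
    finally have rel: "c 0 * g ^ Suc D + f * (\<Sum>j\<le>D. c (Suc j) * (f ^ j * g ^ (D - j))) = 0"
      by (simp only: Suc.prems(2))
    then have "f dvd c 0 * g ^ Suc D"
      by (simp only: add_eq_0_iff2 dvd_minus_iff dvd_triv_left)
    then have "f dvd c 0"
      by (rule coprime_poly_dvd_power[OF \<open>f \<noteq> 0\<close> fg[unfolded coprime_commute[of f]]])
    then have c0: "c 0 = 0" using less 1 Suc.prems(1)[of 0] by simp
    then have "(\<Sum>j\<le>D. c (Suc j) * (f ^ j * g ^ (D - j))) = 0"
      using rel \<open>f \<noteq> 0\<close> by simp
    then have "c (Suc i) = 0" if "i \<le> D" for i
      using Suc.IH[of "\<lambda>j. c (Suc j)" i] Suc.prems(1) that by simp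
    then show ?thesis using c0 Suc.prems(3) by (cases j) auto
  next
    case 2
    then have "g \<noteq> 0" using n by auto
    have "(\<Sum>j\<le>D. c j * (f ^ j * g ^ (Suc D - j))) =
        g * (\<Sum>j\<le>D. c j * (f ^ j * g ^ (D - j)))"
      by (simp add: sum_distrib_left Suc_diff_le mult_ac)
    then have rel: "g * (\<Sum>j\<le>D. c j * (f ^ j * g ^ (D - j))) + c (Suc D) * f ^ Suc D = 0"
      using Suc.prems(2) by simp
    then have "g dvd c (Suc D) * f ^ Suc D"
      by (simp only: add_eq_0_iff dvd_minus_iff dvd_triv_left)
    then have "g dvd c (Suc D)"
      by (rule coprime_poly_dvd_power[OF \<open>g \<noteq> 0\<close> fg])
    then have cD: "c (Suc D) = 0" using less 2 Suc.prems(1)[of "Suc D"] by simp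
    then have "(\<Sum>j\<le>D. c j * (f ^ j * g ^ (D - j))) = 0"
      using rel \<open>g \<noteq> 0\<close> by simp
    then have "c i = 0" if "i \<le> D" for i
      using Suc.IH[of c i] Suc.prems(1) that by simp
    then show ?thesis using cD Suc.prems(3) le_Suc_eq by auto
  qed
qed

text \<open>Homogenisation of p. The exponent D may exceed the degree of p, so that one power of g
  serves several polynomials at once.\<close>

lemma ev_Fract_homogeneous:
  assumes "g \<noteq> 0" "degree p \<le> D"
  shows "ev p (emb f / emb g) * emb g ^ D =
    emb (\<Sum>j\<le>D. smult (coeff p j) (f ^ j * g ^ (D - j)))"
proof -
  have "cst (coeff p j) * (emb f / emb g) ^ j * emb g ^ D =
      emb (smult (coeff p j) (f ^ j * g ^ (D - j)))" if "j \<le> D" for j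
  proof -
    have "emb (smult (coeff p j) (f ^ j * g ^ (D - j))) =
        emb ([:coeff p j:] * (f ^ j * g ^ (D - j)))" by simp
    also have "\<dots> = cst (coeff p j) * (emb f ^ j * emb g ^ (D - j))"
      by (simp only: emb_simps emb_power cst_def)
    finally show ?thesis
      using assms(1) that by (simp add: power_divide power_diff)
  qed
  then show ?thesis
    unfolding ev_altdef_le[OF assms(2)] emb_sum sum_distrib_right by (intro sum.cong) auto
qed

text \<open>Numerators and denominator are polynomials in y rather than in x; after multiplication
  by B(y), a relation over F_q(y) has coefficients in F_q[y].\<close>

lemma common_denominator:
  assumes "finite I" "\<And>i. i \<in> I \<Longrightarrow> u i \<in> field_adjoin constants y"
  obtains B where "ev B y \<noteq> 0" "\<And>i. i \<in> I \<Longrightarrow> \<exists>A. u i * ev B y = ev A y"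
proof -
  have "\<exists>B. ev B y \<noteq> 0 \<and> (\<forall>i\<in>I. \<exists>A. u i * ev B y = ev A y)"
    using assms
  proof (induction I)
    case empty
    have "ev 1 y \<noteq> 0" by simp
    then show ?case by blast
  next
    case (insert i I)
    obtain B where B: "ev B y \<noteq> 0" "\<forall>i\<in>I. \<exists>A. u i * ev B y = ev A y"
      using insert by blast
    obtain p q where pq: "u i = ev p y / ev q y" "ev q y \<noteq> 0"
      using insert.prems[of i] unfolding field_adjoin_fractions by blast
    have "\<exists>A. u k * ev (B * q) y = ev A y" if k: "k \<in> insert i I" for k
    proof (cases "k = i")
      case True
      then have "u k * ev (B * q) y = ev (p * B) y" using pq by simp
      then show ?thesis by blast
    next
      case False
      then obtain A where "u k * ev B y = ev A y" using B k by blast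
      then have "u k * ev (B * q) y = ev (A * q) y" by simp
      then show ?thesis by blast
    qed
    moreover have "ev (B * q) y \<noteq> 0" using B(1) pq(2) by simp
    ultimately show ?case by blast
  qed
  then show thesis using that by blast
qed

text \<open>This is the lower bound for the degree of x over F_q(h). A relation of degree m below
  \<open>rf_degree h\<close> becomes, after clearing denominators and regrouping by powers of h, a
  relation whose coefficients are polynomials in x of degree at most m. By
  \<open>homogeneous_relation_trivial\<close> all of these vanish.\<close>

lemma rf_degree_le_degree:
  fixes P :: "'a::field poly fract poly"
  assumes "P \<noteq> 0" and coeffs: "\<And>i. coeff P i \<in> field_adjoin constants h"
    and root: "poly P indet = 0"
  shows "rf_degree h \<le> degree P"
proof (rule ccontr)
  obtain f g where g: "g \<noteq> 0" and fg: "coprime f g" and h: "h = Fract f g"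
    by (rule coprime_representation)
  define n where "n = max (degree f) (degree g)"
  have n: "rf_degree h = n" using rf_degree_Fract[OF g fg] h n_def by simp
  define m where "m = degree P"
  assume "\<not> rf_degree h \<le> degree P"
  then have "m < n" using n m_def by simp
  obtain B where B: "ev B h \<noteq> 0" "\<And>i. i \<in> {..m} \<Longrightarrow> \<exists>A. coeff P i * ev B h = ev A h"
    using common_denominator[of "{..m}" "coeff P" h] coeffs by auto
  then obtain A where A: "\<And>i. i \<le> m \<Longrightarrow> coeff P i * ev B h = ev (A i) h"
    by (metis atMost_iff)
  \<comment> \<open>A bound for all the A i, so that the single factor g^D clears h = f/g from every
    term.\<close>
  define D where "D = Max ((\<lambda>i. degree (A i)) ` {..m})"
  have D: "degree (A i) \<le> D" if "i \<le> m" for i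
    unfolding D_def using that by (intro Max_ge) auto
  \<comment> \<open>The array of coefficients \<open>coeff (A i) j\<close> read the other way: A i
    collects the powers of h that go with x^i, and c j collects the powers of x that go with
    h^j.\<close>
  define c where "c j = (\<Sum>i\<le>m. monom (coeff (A i) j) i)" for j
  have coeff_c: "coeff (c j) i = coeff (A i) j" if "i \<le> m" for i j
    unfolding c_def coeff_sum coeff_monom using that by (simp add: if_distrib sum.delta cong: if_cong)
  have deg_c: "degree (c j) < n" for j
  proof -
    have "degree (c j) \<le> m" unfolding c_def
      by (intro degree_sum_le) (auto intro: order.trans[OF degree_monom_le])
    then show ?thesis using \<open>m < n\<close> by simp
  qed
  have h': "h = emb f / emb g" using h g by (simp add: Fract_emb)
  have ev_A: "ev (A i) h * emb g ^ D * indet ^ i =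
      emb (\<Sum>j\<le>D. monom (coeff (A i) j) i * (f ^ j * g ^ (D - j)))" if "i \<le> m" for i
  proof -
    have "monom a i * p = smult a p * [:0, 1:] ^ i" for a and p :: "'a poly"
      by (simp add: monom_altdef mult.commute)
    then have "(\<Sum>j\<le>D. monom (coeff (A i) j) i * (f ^ j * g ^ (D - j))) =
        (\<Sum>j\<le>D. smult (coeff (A i) j) (f ^ j * g ^ (D - j))) * [:0, 1:] ^ i"
      by (simp only: sum_distrib_right)
    then show ?thesis
      using ev_Fract_homogeneous[OF g D[OF that], of f]
      by (simp only: h' emb_simps emb_power indet_def)
  qed
  have "0 = poly P indet * (ev B h * emb g ^ D)" using root by simp
  also have "\<dots> = (\<Sum>i\<le>m. coeff P i * indet ^ i * (ev B h * emb g ^ D))"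
    unfolding poly_altdef m_def sum_distrib_right ..
  also have "\<dots> = (\<Sum>i\<le>m. ev (A i) h * emb g ^ D * indet ^ i)"
    by (intro sum.cong refl) (simp add: A[symmetric] mult_ac)
  also have "\<dots> = emb (\<Sum>i\<le>m. \<Sum>j\<le>D. monom (coeff (A i) j) i * (f ^ j * g ^ (D - j)))"
    unfolding emb_sum[of _ "{..m}"] by (intro sum.cong refl) (simp add: ev_A)
  also have "\<dots> = emb (\<Sum>j\<le>D. c j * (f ^ j * g ^ (D - j)))"
    unfolding c_def sum_distrib_right by (subst sum.swap) simp
  finally have rel: "(\<Sum>j\<le>D. c j * (f ^ j * g ^ (D - j))) = 0"
    using emb_eq_0_iff by metis
  have c0: "c j = 0" if "j \<le> D" for j
    using homogeneous_relation_trivial[OF fg n_def _ deg_c rel that] \<open>m < n\<close> by simp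
  \<comment> \<open>The top index m suffices for the contradiction: A m is the cleared leading
    coefficient of P.\<close>
  have "coeff (A m) j = 0" for j
  proof (cases "j \<le> D")
    case True
    then show ?thesis using coeff_c[of m j] c0 by simp
  next
    case False
    then show ?thesis using D[of m] by (simp add: coeff_eq_0)
  qed
  then have "A m = 0" by (simp add: poly_eq_iff)
  then have "lead_coeff P * ev B h = 0" using A[of m] m_def by simp
  then show False using B(1) assms(1) by simp
qed

section \<open>The order of the Galois group\<close>

lemma rf_degree_cst [simp]: "rf_degree (cst c) = 0"
  using rf_degree_Fract[of 1 "[:c:]"] by (simp add: cst_def emb_def)

lemma Fq_t_subfield: "is_subfield (Fq_t h)"
  and constants_subset_Fq_t: "constants \<subseteq> Fq_t h"
  and in_Fq_t: "h \<in> Fq_t h"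
  unfolding Fq_t_def by (fact field_adjoin_subfield field_adjoin_base)+

text \<open>Applying \<sigma> to h g(x) = f(x) fixes h, so \<sigma>(x) is a root of f(Y) - h g(Y),
  which has degree at most \<open>rf_degree h\<close>; and \<sigma>(x) determines \<sigma>.\<close>

lemma field_auts_Fq_t_card:
  assumes "0 < rf_degree h"
  shows "finite (field_auts (Fq_t h))" "card (field_auts (Fq_t h)) \<le> rf_degree h"
proof -
  obtain f g where g: "g \<noteq> 0" and fg: "coprime f g" and h: "h = Fract f g"
    by (rule coprime_representation)
  have n: "rf_degree h = max (degree f) (degree g)" using rf_degree_Fract[OF g fg] h by simp
  have h': "h = emb f / emb g" using h g by (simp add: Fract_emb)
  define P where "P = map_poly cst f - smult h (map_poly cst g)"
  have poly_P: "poly P y = ev f y - h * ev g y" for y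
    by (simp add: P_def ev_def)
  have coeff_P: "coeff P k = cst (coeff f k) - h * cst (coeff g k)" for k
    by (simp add: P_def coeff_map_poly)
  have "P \<noteq> 0"
  proof
    assume "P = 0"
    \<comment> \<open>At the index \<open>degree g\<close> the coefficient of g is nonzero, so the
      vanishing of P could be solved for h and would make h a constant.\<close>
    have "cst (coeff f (degree g)) = h * cst (lead_coeff g)"
      using coeff_P[of "degree g"] \<open>P = 0\<close> by simp
    then have "h = cst (coeff f (degree g)) * inverse (cst (lead_coeff g))"
      using g by simp
    then have "h = cst (coeff f (degree g) * inverse (lead_coeff g))"
      by (simp only: inverse_cst cst_simps)
    then have "rf_degree h = 0" by (simp only: rf_degree_cst)
    then show False using assms by simp
  qed
  have "degree P \<le> rf_degree h"
    by (rule degree_le) (auto simp: coeff_P n coeff_eq_0)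
  then have roots: "finite {y. poly P y = 0}" "card {y. poly P y = 0} \<le> rf_degree h"
    using card_poly_roots_bound[OF \<open>P \<noteq> 0\<close>] poly_roots_finite[OF \<open>P \<noteq> 0\<close>] by simp_all
  have maps: "(\<lambda>\<sigma>. \<sigma> indet) ` field_auts (Fq_t h) \<subseteq> {y. poly P y = 0}"
  proof clarify
    fix \<sigma> assume s: "\<sigma> \<in> field_auts (Fq_t h)"
    have "h * ev g indet = ev f indet" using g by (simp add: h')
    then have "\<sigma> h * ev g (\<sigma> indet) = ev f (\<sigma> indet)"
      by (metis field_autsD(3)[OF s] field_auts_ev[OF s constants_subset_Fq_t])
    then show "poly P (\<sigma> indet) = 0"
      using field_autsD(4)[OF s in_Fq_t] by (simp add: poly_P)
  qed
  have inj: "inj_on (\<lambda>\<sigma>. \<sigma> indet) (field_auts (Fq_t h))"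
    by (rule inj_onI) (rule field_auts_eqI[OF _ _ constants_subset_Fq_t])
  show "finite (field_auts (Fq_t h))"
    using finite_imageD[OF finite_subset[OF maps roots(1)] inj] .
  show "card (field_auts (Fq_t h)) \<le> rf_degree h"
    using card_inj_on_le[OF inj maps roots(1)] roots(2) by simp
qed

lemma map_poly_field_aut:
  assumes "\<sigma> \<in> field_auts K"
  shows "map_poly \<sigma> (p * q) = map_poly \<sigma> p * map_poly \<sigma> q"
proof -
  have sum: "\<sigma> (\<Sum>i\<in>A. u i) = (\<Sum>i\<in>A. \<sigma> (u i))" for A :: "nat set" and u
    by (induction A rule: infinite_finite_induct)
      (simp_all add: field_autsD[OF assms] field_auts_hom[OF assms])
  show ?thesis
    by (rule poly_eqI)
      (simp add: coeff_map_poly coeff_mult field_auts_hom[OF assms] sum field_autsD[OF assms])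
qed

lemma map_poly_field_aut_prod:
  assumes "\<sigma> \<in> field_auts K"
  shows "map_poly \<sigma> (\<Prod>i\<in>A. [:- u i, 1:]) = (\<Prod>i\<in>A. [:- \<sigma> (u i), 1:])"
  by (induction A rule: infinite_finite_induct)
    (simp_all add: map_poly_field_aut[OF assms] map_poly_pCons field_auts_hom[OF assms]
      del: mult_pCons_left)

lemma field_auts_comp_bij:
  assumes "\<sigma> \<in> field_auts K"
  shows "bij_betw (\<lambda>\<tau>. \<sigma> \<circ> \<tau>) (field_auts K) (field_auts K)"
  using field_auts_inv[OF assms] assms
  by (intro bij_betw_byWitness[where f' = "\<lambda>\<tau>. inv_into UNIV \<sigma> \<circ> \<tau>"])
    (auto simp: fun_eq_iff intro: field_auts_comp)

text \<open>Artin's argument: the product of the Y - \<tau>(x) is permuted into itself by the group,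
  so being Galois puts its coefficients into \<open>Fq_t h\<close>. It vanishes at x, and its degree
  is the order of the group.\<close>

lemma card_field_auts_Fq_t:
  assumes "0 < rf_degree h" and galois: "galois_extension (Fq_t h)"
  shows "card (field_auts (Fq_t h)) = rf_degree h"
proof -
  let ?G = "field_auts (Fq_t h)"
  have fin: "finite ?G" using field_auts_Fq_t_card[OF assms(1)] by simp
  define P where "P = (\<Prod>\<tau>\<in>?G. [:- \<tau> indet, 1:])"
  have "coeff P i \<in> Fq_t h" for i
  proof -
    have "\<sigma> (coeff P i) = coeff P i" if s: "\<sigma> \<in> ?G" for \<sigma>
    proof -
      have "map_poly \<sigma> P = (\<Prod>\<tau>\<in>?G. [:- (\<sigma> \<circ> \<tau>) indet, 1:])"
        unfolding P_def map_poly_field_aut_prod[OF s] by simp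
      also have "\<dots> = P"
        unfolding P_def by (rule prod.reindex_bij_betw[OF field_auts_comp_bij[OF s]])
      finally show ?thesis by (metis coeff_map_poly field_auts_hom(1)[OF s])
    qed
    then show ?thesis using galois unfolding galois_extension_def by blast
  qed
  then have coeffs: "coeff P i \<in> field_adjoin constants h" for i by (simp add: Fq_t_def)
  have "P \<noteq> 0" using fin by (simp add: P_def)
  have "poly P indet = 0"
    using fin field_auts_id by (auto simp: P_def poly_prod intro!: bexI[of _ id])
  then have "rf_degree h \<le> degree P"
    using rf_degree_le_degree[OF \<open>P \<noteq> 0\<close> coeffs] by simp
  also have "degree P = card ?G" by (simp add: P_def degree_prod_eq_sum_degree)
  finally show ?thesis using field_auts_Fq_t_card[OF assms(1)] by simp
qed

section \<open>Automorphisms as Moebius transformations\<close>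

lemma rf_degree_aut_indet_le:
  assumes "\<sigma> \<in> field_auts K" "constants \<subseteq> K"
  shows "rf_degree (\<sigma> indet) \<le> 1"
proof -
  let ?F = "field_adjoin constants (\<sigma> indet)"
  \<comment> \<open>Surjectivity of \<sigma> makes \<sigma>(x) a generator of the whole field. Then
    Y - x has coefficients in ?F, and \<open>rf_degree_le_degree\<close> applies to it.\<close>
  have "z \<in> ?F" for z
  proof -
    obtain f g where "g \<noteq> 0" "inv_into UNIV \<sigma> z = Fract f g"
      by (cases "inv_into UNIV \<sigma> z") auto
    then have "z = \<sigma> (ev f indet / ev g indet)"
      using field_auts_inv[OF assms(1)] by (metis Fract_emb ev_indet)
    also have "\<dots> = ev f (\<sigma> indet) / ev g (\<sigma> indet)"
      by (simp only: field_auts_hom[OF assms(1)] field_auts_ev[OF assms])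
    finally show ?thesis
      using ev_in_subfield[OF is_subfield_closed(1)[OF field_adjoin_subfield] field_adjoin_base]
        is_subfield_closed(3)[OF field_adjoin_subfield] by metis
  qed
  then show ?thesis
    using rf_degree_le_degree[of "[:- indet, 1:]" "\<sigma> indet"] by simp
qed

lemma aut_indet_mobius:
  assumes "\<sigma> \<in> field_auts K" "constants \<subseteq> K"
  obtains A B where "coprime A B" "B \<noteq> 0" "degree A \<le> 1" "degree B \<le> 1"
    "\<sigma> indet = emb A / emb B"
proof -
  obtain A B where AB: "B \<noteq> 0" "coprime A B" "\<sigma> indet = Fract A B"
    by (rule coprime_representation)
  then show thesis
    using that rf_degree_aut_indet_le[OF assms] rf_degree_Fract[OF AB(1,2)]
    by (simp add: Fract_emb)
qed

section \<open>Places\<close>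

lemma place_ring_nonunits:
  assumes "valuation_ring k E R"
  shows "place_ring E (nonunits R) = R"
  using assms is_subring_closed(1)[of R]
  unfolding valuation_ring_def place_ring_def nonunits_def by auto

lemma places_valuation_ring:
  assumes "P \<in> places k E"
  shows "valuation_ring k E (place_ring E P)" "P = nonunits (place_ring E P)"
proof -
  obtain R where "P = nonunits R" "valuation_ring k E R"
    using assms by (auto simp: places_def)
  then show "valuation_ring k E (place_ring E P)" "P = nonunits (place_ring E P)"
    using place_ring_nonunits[of k E R] by simp_all
qed

lemma
  assumes "P \<in> places k E" "is_subfield E"
  shows place_ring_subring: "is_subring (place_ring E P)"
    and constants_in_place_ring: "k \<subset> place_ring E P"
    and place_ring_subset: "place_ring E P \<subset> E"
    and place_subset_ring: "P \<subseteq> place_ring E P"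
    and place_zero: "0 \<in> P"
    and place_one: "1 \<notin> P"
    and place_ring_inverse: "u \<in> place_ring E P \<Longrightarrow> u \<notin> P \<Longrightarrow> inverse u \<in> place_ring E P"
    and place_ring_not: "u \<in> E \<Longrightarrow> u \<notin> place_ring E P \<Longrightarrow> inverse u \<in> P"
    and place_inverse: "u \<in> P \<Longrightarrow> inverse u \<in> place_ring E P \<Longrightarrow> u = 0"
proof -
  let ?R = "place_ring E P"
  note R = places_valuation_ring[OF assms(1)]
  show ring: "is_subring ?R" and "k \<subset> ?R" and "?R \<subset> E"
    using R(1) by (auto simp: valuation_ring_def)
  have P: "x \<in> P \<longleftrightarrow> x \<in> ?R \<and> (x = 0 \<or> inverse x \<notin> ?R)" for x
    using R(2) unfolding nonunits_def by blast
  show "P \<subseteq> ?R" using P by blast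
  show "0 \<in> P" "1 \<notin> P"
    using is_subring_closed(1,2)[OF ring] unfolding P by simp_all
  show "inverse u \<in> ?R" if "u \<in> ?R" "u \<notin> P"
    using that P by blast
  show "u = 0" if "u \<in> P" "inverse u \<in> ?R"
    using that P by blast
  show "inverse u \<in> P" if "u \<in> E" "u \<notin> ?R"
    using that unfolding place_ring_def by auto
qed

lemma place_mult:
  assumes "P \<in> places k E" "is_subfield E" "u \<in> P" "v \<in> place_ring E P"
  shows "u * v \<in> P"
proof (rule ccontr)
  assume *: "u * v \<notin> P"
  have "u * v \<in> place_ring E P"
    using assms place_subset_ring is_subring_closed(5)[OF place_ring_subring[OF assms(1,2)]] by blast
  then have inv: "inverse (u * v) \<in> place_ring E P" using place_ring_inverse[OF assms(1,2)] * by blast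
  have "v \<noteq> 0" using * place_zero[OF assms(1,2)] by auto
  then have eq: "inverse u = v * inverse (u * v)" by simp
  have "inverse u \<in> place_ring E P"
    unfolding eq by (rule is_subring_closed(5)[OF place_ring_subring[OF assms(1,2)] assms(4) inv])
  then have "u = 0" using place_inverse assms by blast
  then show False using * place_zero[OF assms(1,2)] by simp
qed

text \<open>Factor out a summand: u + v = u (1 + v/u). One of v/u and u/v lies in the valuation
  ring, and the two cases are symmetric.\<close>

lemma place_add:
  assumes "P \<in> places k E" "is_subfield E" "u \<in> P" "v \<in> P"
  shows "u + v \<in> P"
proof -
  let ?R = "place_ring E P"
  note ring = is_subring_closed[OF place_ring_subring[OF assms(1,2)]]
  have *: "u + v \<in> P" if "u \<noteq> 0" "u \<in> P" "v / u \<in> ?R" for u v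
  proof -
    have "u + v = u * (1 + v / u)" using that by (simp add: field_simps)
    then show ?thesis using place_mult[OF assms(1,2) that(2)] that(3) ring by simp
  qed
  consider "u = 0" | "v = 0" | "u \<noteq> 0" "v \<noteq> 0" by blast
  then show ?thesis
  proof cases
    case 3
    have "u \<in> E" "v \<in> E"
      using assms place_subset_ring place_ring_subset by blast+
    then have "v / u \<in> E" using is_subfield_closed(3)[OF assms(2)] by blast
    then have "v / u \<in> ?R \<or> u / v \<in> ?R"
      using place_ring_not[OF assms(1,2)] place_subset_ring[OF assms(1,2)] inverse_divide by (metis subsetD)
    then show ?thesis using *[of u v] *[of v u] 3 assms(3,4) by (auto simp: add.commute)
  qed (use assms in auto)
qed

lemma place_diff:
  assumes "P \<in> places k E" "is_subfield E" "u \<in> P" "v \<in> P"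
  shows "u - v \<in> P"
proof -
  note ring = is_subring_closed[OF place_ring_subring[OF assms(1,2)]]
  have "v * - 1 \<in> P"
    by (rule place_mult[OF assms(1,2,4) ring(6)[OF ring(2)]])
  then show ?thesis using place_add[OF assms(1,2,3), of "- v"] by simp
qed

lemma place_prime:
  assumes "P \<in> places k E" "is_subfield E" "u * v \<in> P" "u \<in> place_ring E P" "v \<in> place_ring E P"
  shows "u \<in> P \<or> v \<in> P"
proof (rule ccontr)
  assume *: "\<not> ?thesis"
  then have "u * v * inverse u \<in> P"
    using place_mult[OF assms(1,2,3)] place_ring_inverse[OF assms(1,2)] assms(4) by blast
  moreover have "u \<noteq> 0" using * place_zero[OF assms(1,2)] by auto
  then have "u * v * inverse u = v" by simp
  ultimately show False using * by simp
qed

lemma place_constant: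
  assumes "P \<in> places k E" "is_subfield E" "is_subfield k" "c \<in> k" "c \<in> P"
  shows "c = 0"
  using assms place_inverse is_subfield_closed(2) constants_in_place_ring by blast

lemma cst_in_place_iff:
  assumes "P \<in> places constants UNIV"
  shows "cst c \<in> P \<longleftrightarrow> c = 0"
  using place_constant[OF assms is_subfield_UNIV is_subfield_constants, of "cst c"]
    place_zero[OF assms is_subfield_UNIV] by (auto simp: constants_eq)

text \<open>Degree one in working form: every residue comes from a constant. The basis is {1}, and
  coordinates are unique because k meets P only in zero.\<close>

lemma rational_placesI:
  assumes "P \<in> places k E" "is_subfield E" "is_subfield k"
    and "\<And>z. z \<in> place_ring E P \<Longrightarrow> \<exists>c\<in>k. z - c \<in> P"
  shows "P \<in> rational_places k E"
proof -
  have "\<exists>!c. c \<in> {1} \<rightarrow>\<^sub>E k \<and> z - (\<Sum>b\<in>{1}. c b * b) \<in> P" if z: "z \<in> place_ring E P" for z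
  proof -
    obtain c where c: "c \<in> k" "z - c \<in> P" using assms(4)[OF z] by blast
    show ?thesis
    proof (rule ex1I[of _ "\<lambda>b\<in>{1}. c"])
      show "(\<lambda>b\<in>{1}. c) \<in> {1} \<rightarrow>\<^sub>E k \<and> z - (\<Sum>b\<in>{1}. (\<lambda>b\<in>{1}. c) b * b) \<in> P"
        using c by auto
    next
      fix d assume d: "d \<in> {1} \<rightarrow>\<^sub>E k \<and> z - (\<Sum>b\<in>{1}. d b * b) \<in> P"
      then have "z - d 1 \<in> P" by simp
      then have "(z - c) - (z - d 1) \<in> P" using place_diff[OF assms(1,2)] c(2) by blast
      then have "d 1 - c \<in> P" by simp
      moreover have "d 1 \<in> k" using d by blast
      then have "d 1 - c \<in> k"
        using is_subring_closed(3)[OF is_subfield_closed(1)[OF assms(3)]] c(1) by blast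
      ultimately have "d 1 - c = 0" by (intro place_constant[OF assms(1,2,3)])
      then show "d = (\<lambda>b\<in>{1}. c)" using d by (auto simp: PiE_def extensional_def)
    qed
  qed
  moreover have "1 \<in> place_ring E P"
    using is_subring_closed(2)[OF place_ring_subring[OF assms(1,2)]] .
  ultimately have "has_place_degree k E P 1"
    unfolding has_place_degree_def by (intro exI[of _ "{1}"]) auto
  then show ?thesis using assms(1) by (simp add: rational_places_def)
qed

text \<open>The one-element basis {b} of the residue field may have b different from 1. From 1 = d b
  and z = e b modulo P, rescaling gives z = e/d modulo P.\<close>

lemma rational_placesD:
  assumes "P \<in> rational_places k E" "is_subfield E" "is_subfield k"
  shows "P \<in> places k E" and "z \<in> place_ring E P \<Longrightarrow> \<exists>c\<in>k. z - c \<in> P"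
proof -
  show P: "P \<in> places k E" using assms(1) by (simp add: rational_places_def)
  assume z: "z \<in> place_ring E P"
  note k = is_subfield_closed[OF assms(3)]
  have "has_place_degree k E P 1" using assms(1) by (simp add: rational_places_def)
  then obtain b where b: "b \<in> place_ring E P"
    and c: "\<And>z. z \<in> place_ring E P \<Longrightarrow> \<exists>c\<in>k. z - c * b \<in> P"
    unfolding has_place_degree_def One_nat_def card_1_singleton_iff
    by (auto simp: Pi_iff) (metis PiE_mem singletonI)
  have "1 \<in> place_ring E P" using is_subring_closed(2)[OF place_ring_subring[OF P assms(2)]] .
  then obtain d where d: "d \<in> k" "1 - d * b \<in> P" using c by blast
  obtain e where e: "e \<in> k" "z - e * b \<in> P" using c z by blast
  have "d \<noteq> 0" using d place_one[OF P assms(2)] by auto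
  then have "(z - e * b) - (1 - d * b) * (e / d) = z - e / d" by (simp add: field_simps)
  moreover have "e / d \<in> k" using k d e by blast
  moreover from this have "e / d \<in> place_ring E P"
    using constants_in_place_ring[OF P assms(2)] by blast
  ultimately show "\<exists>c\<in>k. z - c \<in> P"
    using place_diff[OF P assms(2) e(2) place_mult[OF P assms(2) d(2)]] by metis
qed

section \<open>The rational places of \<open>F\<^sub>q(x)\<close>\<close>

definition finite_place :: "'a::field \<Rightarrow> 'a poly fract set" where
  "finite_place a = {emb u / emb v | u v. poly u a = 0 \<and> poly v a \<noteq> 0}"

text \<open>Since \<open>degree 0 = 0\<close>, the comparison of degrees would reject zero over a
  constant denominator. The disjunct \<open>u = 0\<close> makes the criterion hold for every
  representation of an element.\<close>

definition infinite_place :: "'a::field poly fract set" where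
  "infinite_place = {emb u / emb v | u v. v \<noteq> 0 \<and> (u = 0 \<or> degree u < degree v)}"

lemma fract_coprime_cases:
  obtains u v where "v \<noteq> 0" "coprime u v" "z = emb u / emb v"
proof -
  obtain u v where "v \<noteq> 0" "coprime u v" "z = Fract u v"
    by (rule coprime_representation)
  then show thesis using that by (simp add: Fract_emb)
qed

lemma coprime_poly_roots:
  fixes u v :: "'a::field poly"
  assumes "coprime u v" "poly u a = 0"
  shows "poly v a \<noteq> 0"
proof
  assume "poly v a = 0"
  then have "is_unit [:- a, 1:]" using assms by (meson coprime_common_divisor poly_eq_0_iff_dvd)
  then show False by (simp add: is_unit_poly_iff)
qed

lemma emb_divide_eq_iff:
  assumes "v \<noteq> 0" "v' \<noteq> 0"
  shows "emb u / emb v = emb u' / emb v' \<longleftrightarrow> u * v' = u' * v"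
proof -
  have "emb u / emb v = emb u' / emb v' \<longleftrightarrow> emb (u * v') = emb (u' * v)"
    using assms by (simp add: frac_eq_eq)
  then show ?thesis by (simp only: emb_simps(7))
qed

lemma emb_divide_in_finite_place:
  assumes "v \<noteq> 0" "emb u / emb v \<in> finite_place a"
  shows "poly u a = 0"
proof -
  obtain u' v' where *: "emb u / emb v = emb u' / emb v'" "poly v' a \<noteq> 0" "poly u' a = 0"
    using assms(2) unfolding finite_place_def by auto
  then have "u * v' = u' * v" using emb_divide_eq_iff assms(1) by (metis poly_0)
  then have "poly u a * poly v' a = poly u' a * poly v a" by (metis poly_mult)
  then show "poly u a = 0" using * by simp
qed

lemma finite_place_place:
  fixes a :: "'a::field"
  shows "finite_place a \<in> places constants UNIV"
proof -
  define R :: "'a poly fract set" where "R = {emb u / emb v | u v. poly v a \<noteq> 0}"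
  \<comment> \<open>Lowest terms matter: a common factor x - a would make v(a) vanish although the
    quotient has no pole at a.\<close>
  have R: "emb u / emb v \<in> R \<longleftrightarrow> poly v a \<noteq> 0" if uv: "v \<noteq> 0" "coprime u v" for u v
  proof
    assume "emb u / emb v \<in> R"
    then obtain u' v' where eq: "emb u / emb v = emb u' / emb v'" and v': "poly v' a \<noteq> 0"
      unfolding R_def by auto
    then have "u * v' = u' * v" using emb_divide_eq_iff uv by (metis poly_0)
    then have "poly u a * poly v' a = poly u' a * poly v a" by (metis poly_mult)
    then show "poly v a \<noteq> 0" using v' coprime_poly_roots[of v u a] uv(2)
      by (auto simp: coprime_commute)
  qed (auto simp: R_def)
  have RI: "emb u / emb v \<in> R" if "poly v a \<noteq> 0" for u v
    using that unfolding R_def by blast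
  have "is_subring R" unfolding is_subring_def
  proof (intro conjI ballI)
    show "1 \<in> R" using RI[of 1 1] by simp
    fix z w assume "z \<in> R" "w \<in> R"
    then obtain u v u' v' where z: "z = emb u / emb v" "poly v a \<noteq> 0"
      and w: "w = emb u' / emb v'" "poly v' a \<noteq> 0"
      unfolding R_def by auto
    then have "v \<noteq> 0" "v' \<noteq> 0" by auto
    then have "z - w = emb (u * v' - u' * v) / emb (v * v')" "z * w = emb (u * u') / emb (v * v')"
      unfolding z(1) w(1) by (simp_all add: diff_frac_eq)
    moreover have "poly (v * v') a \<noteq> 0" using z w by simp
    ultimately show "z - w \<in> R" "z * w \<in> R" unfolding R_def by blast+
  qed
  moreover have "constants \<subset> R"
  proof
    have "cst c \<in> R" for c using RI[of 1 "[:c:]"] by (simp add: cst_def)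
    then show "constants \<subseteq> R" by (auto simp: constants_eq)
    have "indet \<in> R" using RI[of 1 "[:0, 1:]"] by (simp add: indet_def)
    moreover have "indet \<notin> constants" by (auto simp: indet_def constants_eq cst_def)
    ultimately show "constants \<noteq> R" by blast
  qed
  moreover have "R \<subset> UNIV"
    using R[of "[:- a, 1:]" 1] by auto
  moreover have "z \<in> R \<or> inverse z \<in> R" for z
  proof -
    obtain u v where uv: "v \<noteq> 0" "coprime u v" "z = emb u / emb v" by (rule fract_coprime_cases)
    show ?thesis
    proof (cases "poly v a = 0")
      case True
      then have "poly u a \<noteq> 0" using coprime_poly_roots[of v u a] uv(2) by (simp add: coprime_commute)
      then show ?thesis unfolding uv(3) inverse_divide R_def by blast
    next
      case False
      then show ?thesis using uv R by simp
    qed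
  qed
  ultimately have "valuation_ring constants UNIV R" by (simp add: valuation_ring_def)
  moreover have "finite_place a = nonunits R"
  proof (rule Set.set_eqI)
    fix z :: "'a poly fract"
    obtain u v where uv: "v \<noteq> 0" "coprime u v" "z = emb u / emb v" by (rule fract_coprime_cases)
    have "z \<in> finite_place a \<longleftrightarrow> poly u a = 0"
    proof
      assume "z \<in> finite_place a"
      then show "poly u a = 0" using emb_divide_in_finite_place uv by blast
    next
      assume "poly u a = 0"
      then show "z \<in> finite_place a"
        using coprime_poly_roots[OF uv(2)] uv(3) unfolding finite_place_def by blast
    qed
    also have "\<dots> \<longleftrightarrow> z \<in> nonunits R"
    proof (cases "u = 0")
      case True
      then show ?thesis using uv(3) RI[of 1 0] by (simp add: nonunits_def)
    next
      case False
      have "inverse z \<in> R \<longleftrightarrow> poly u a \<noteq> 0"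
        using R[of u v] False uv by (simp add: coprime_commute)
      then show ?thesis using R[of v u] uv False coprime_poly_roots[OF uv(2)] by (auto simp: nonunits_def)
    qed
    finally show "z \<in> finite_place a \<longleftrightarrow> z \<in> nonunits R" .
  qed
  ultimately show ?thesis by (auto simp: places_def)
qed

lemma emb_divide_degree_eq:
  fixes u v u' v' :: "'a::field poly"
  assumes "v \<noteq> 0" "v' \<noteq> 0" "u \<noteq> 0" "emb u / emb v = emb u' / emb v'"
  shows "degree u + degree v' = degree u' + degree v"
proof -
  have eq: "u * v' = u' * v" using assms emb_divide_eq_iff by blast
  then have "u' \<noteq> 0" using assms by auto
  then show ?thesis using arg_cong[OF eq, of degree] assms by (simp add: degree_mult_eq)
qed

lemma emb_divide_in_infinite_place_iff:
  assumes "v \<noteq> 0"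
  shows "emb u / emb v \<in> infinite_place \<longleftrightarrow> u = 0 \<or> degree u < degree v"
proof
  assume "emb u / emb v \<in> infinite_place"
  then obtain u' v' where *: "emb u / emb v = emb u' / emb v'" "v' \<noteq> 0" "u' = 0 \<or> degree u' < degree v'"
    unfolding infinite_place_def by auto
  show "u = 0 \<or> degree u < degree v"
  proof (cases "u = 0")
    case False
    then have "u' \<noteq> 0" using * assms by auto
    then show ?thesis using emb_divide_degree_eq[OF assms *(2) False *(1)] *(3) by auto
  qed simp
next
  assume "u = 0 \<or> degree u < degree v"
  then show "emb u / emb v \<in> infinite_place" unfolding infinite_place_def using assms by blast
qed

lemma infinite_place_place: "(infinite_place :: 'a::field poly fract set) \<in> places constants UNIV"
proof -
  define R :: "'a poly fract set" where "R = {emb u / emb v | u v. v \<noteq> 0 \<and> degree u \<le> degree v}"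
  have RI: "emb u / emb v \<in> R" if "v \<noteq> 0" "degree u \<le> degree v" for u v
    using that unfolding R_def by blast
  \<comment> \<open>Here lowest terms are irrelevant, since cancelling a common factor lowers both
    degrees equally.\<close>
  have R: "emb u / emb v \<in> R \<longleftrightarrow> degree u \<le> degree v" if "v \<noteq> 0" for u v
  proof
    assume "emb u / emb v \<in> R"
    then obtain u' v' where *: "emb u / emb v = emb u' / emb v'" "v' \<noteq> 0" "degree u' \<le> degree v'"
      unfolding R_def by auto
    show "degree u \<le> degree v"
      using emb_divide_degree_eq[OF that *(2) _ *(1)] *(3) by (cases "u = 0") auto
  qed (simp add: RI that)
  have "is_subring R" unfolding is_subring_def
  proof (intro conjI ballI)
    show "1 \<in> R" using RI[of 1 1] by simp
    fix z w assume "z \<in> R" "w \<in> R"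
    then obtain u v u' v' where z: "z = emb u / emb v" "v \<noteq> 0" "degree u \<le> degree v"
      and w: "w = emb u' / emb v'" "v' \<noteq> 0" "degree u' \<le> degree v'"
      unfolding R_def by auto
    have "z - w = emb (u * v' - u' * v) / emb (v * v')" "z * w = emb (u * u') / emb (v * v')"
      unfolding z(1) w(1) using z(2) w(2) by (simp_all add: diff_frac_eq)
    moreover have "degree (u * v' - u' * v) \<le> degree (v * v')" "degree (u * u') \<le> degree (v * v')"
      using z w degree_mult_le[of u v'] degree_mult_le[of u' v] degree_mult_le[of u u']
      by (auto simp: degree_mult_eq intro!: degree_diff_le)
    moreover have "v * v' \<noteq> 0" using z w by simp
    ultimately show "z - w \<in> R" "z * w \<in> R" using RI by presburger+
  qed
  moreover have "constants \<subset> R"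
  proof
    have "cst c \<in> R" for c using RI[of 1 "[:c:]"] by (simp add: cst_def)
    then show "constants \<subseteq> R" by (auto simp: constants_eq)
    have "emb 1 / emb [:0, 1:] \<in> R" by (rule RI) auto
    moreover have "emb 1 / emb [:0, 1:] \<noteq> cst c" for c :: 'a
    proof
      assume "emb 1 / emb [:0, 1:] = cst c"
      then have "emb 1 / emb [:0, 1:] = emb [:c:] / emb 1" by (simp add: cst_def)
      then show False by (subst (asm) emb_divide_eq_iff) (auto simp: one_pCons)
    qed
    ultimately show "constants \<noteq> R" by (auto simp: constants_eq)
  qed
  moreover have "R \<subset> UNIV"
    using R[of 1 "[:0, 1:]"] by auto
  moreover have "z \<in> R \<or> inverse z \<in> R" for z
  proof -
    obtain u v where uv: "v \<noteq> 0" "coprime u v" "z = emb u / emb v" by (rule fract_coprime_cases)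
    show ?thesis
    proof (cases "degree u \<le> degree v")
      case False
      then have "u \<noteq> 0" by auto
      then have "inverse z \<in> R" unfolding uv(3) inverse_divide by (rule RI) (use False in simp)
      then show ?thesis ..
    qed (use uv R in simp)
  qed
  ultimately have "valuation_ring constants UNIV R" by (simp add: valuation_ring_def)
  moreover have "infinite_place = nonunits R"
  proof (rule Set.set_eqI)
    fix z :: "'a poly fract"
    obtain u v where uv: "v \<noteq> 0" "coprime u v" "z = emb u / emb v" by (rule fract_coprime_cases)
    have "z \<in> infinite_place \<longleftrightarrow> u = 0 \<or> degree u < degree v"
      unfolding uv(3) by (rule emb_divide_in_infinite_place_iff[OF uv(1)])
    also have "\<dots> \<longleftrightarrow> z \<in> nonunits R"
    proof (cases "u = 0")
      case True
      then show ?thesis using uv(3) RI[of 1 0] by (simp add: nonunits_def)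
    next
      case False
      then have "inverse z \<in> R \<longleftrightarrow> degree v \<le> degree u" using R[of u v] uv by simp
      then show ?thesis using R[of v u] uv False by (auto simp: nonunits_def)
    qed
    finally show "z \<in> infinite_place \<longleftrightarrow> z \<in> nonunits R" .
  qed
  ultimately show ?thesis by (auto simp: places_def)
qed

section \<open>Recognising a place from the behaviour of x\<close>

lemma emb_in_place_ring:
  assumes "Q \<in> places constants UNIV" "indet \<in> place_ring UNIV Q"
  shows "emb u \<in> place_ring UNIV Q"
  using ev_in_subfield[OF place_ring_subring[OF assms(1) is_subfield_UNIV] _ assms(2)]
    constants_in_place_ring[OF assms(1) is_subfield_UNIV]
  unfolding ev_indet[symmetric] by blast

text \<open>When x is integral at Q, the polynomials in Q determine Q. For z = u/v in lowest terms
  in Q, u = z v lies in Q; were v in Q as well, Bezout would put 1 into Q.\<close>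

lemma place_eq_fractions:
  assumes Q: "Q \<in> places constants UNIV" and x: "indet \<in> place_ring UNIV Q"
  shows "Q = {emb u / emb v | u v. emb u \<in> Q \<and> emb v \<notin> Q}"
proof (intro subset_antisym subsetI)
  note U = is_subfield_UNIV
  fix z assume z: "z \<in> Q"
  obtain u v where uv: "v \<noteq> 0" "coprime u v" "z = emb u / emb v" by (rule fract_coprime_cases)
  have "z * emb v \<in> Q" using place_mult[OF Q U z] emb_in_place_ring[OF Q x] by blast
  then have u: "emb u \<in> Q" using uv by simp
  have "emb v \<notin> Q"
  proof
    assume v: "emb v \<in> Q"
    obtain a b d where d: "d = a * u + b * v" "d \<noteq> 0" "d dvd u" "d dvd v"
      by (rule poly_bezout[OF uv(1)])
    have "is_unit d" using d uv(2) coprime_common_divisor by blast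
    then obtain e where "1 = d * e" by blast
    then have "1 = (u * a + v * b) * e" using d(1) by (simp add: mult.commute)
    then have "emb 1 = (emb u * emb a + emb v * emb b) * emb e"
      by (metis emb_simps(3,5))
    moreover have "(emb u * emb a + emb v * emb b) * emb e \<in> Q"
      by (intro place_mult[OF Q U] place_add[OF Q U] emb_in_place_ring[OF Q x] u v)
    ultimately show False using place_one[OF Q U] by simp
  qed
  then show "z \<in> {emb u / emb v | u v. emb u \<in> Q \<and> emb v \<notin> Q}" using u uv(3) by blast
next
  note U = is_subfield_UNIV
  fix z assume "z \<in> {emb u / emb v | u v. emb u \<in> Q \<and> emb v \<notin> Q}"
  then obtain u v where "z = emb u / emb v" "emb u \<in> Q" "emb v \<notin> Q" by blast
  then show "z \<in> Q"
    using place_mult[OF Q U] place_ring_inverse[OF Q U emb_in_place_ring[OF Q x]]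
    by (simp add: divide_inverse)
qed

text \<open>Division by x - a shows u = u(a) modulo Q, so Q contains exactly the polynomials that
  vanish at a.\<close>

lemma place_finite_eqI:
  assumes "Q \<in> places constants UNIV" "indet - cst a \<in> Q"
  shows "Q = finite_place a"
proof -
  note U = is_subfield_UNIV
  note ring = is_subring_closed[OF place_ring_subring[OF assms(1) U]]
  have cst: "cst c \<in> place_ring UNIV Q" for c
    using constants_in_place_ring[OF assms(1) U] by (auto simp: constants_eq)
  have "indet - cst a + cst a \<in> place_ring UNIV Q"
    using assms(2) place_subset_ring[OF assms(1) U] by (intro ring(4) cst) blast
  then have x: "indet \<in> place_ring UNIV Q" by simp
  have "emb u \<in> Q \<longleftrightarrow> poly u a = 0" for u
  proof -
    define w where "w = synthetic_div u a"
    have "u = [:- a, 1:] * w + [:poly u a:]"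
      using synthetic_div_correct'[of a u] by (simp add: w_def)
    then have "emb u = emb ([:0, 1:] - [:a:]) * emb w + cst (poly u a)"
      unfolding cst_def by (metis emb_simps(3,5) diff_pCons diff_0 diff_0_right)
    then have eq: "emb u = (indet - cst a) * emb w + cst (poly u a)"
      by (simp only: emb_simps cst_def indet_def)
    have in_Q: "(indet - cst a) * emb w \<in> Q"
      using place_mult[OF assms(1) U assms(2)] emb_in_place_ring[OF assms(1) x] by blast
    show ?thesis
    proof
      assume "emb u \<in> Q"
      then have "emb u - (indet - cst a) * emb w \<in> Q" using place_diff[OF assms(1) U _ in_Q] by blast
      then have "cst (poly u a) \<in> Q" using eq by simp
      then show "poly u a = 0" using cst_in_place_iff[OF assms(1)] by simp
    qed (use eq in_Q in simp)
  qed
  then show ?thesis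
    using place_eq_fractions[OF assms(1) x] unfolding finite_place_def by simp
qed

text \<open>With y = 1/x in Q, the product p y^d reduces to the coefficient of x^d in p. For d the
  degree of p this is a unit, so membership of a quotient in Q depends only on the two
  degrees.\<close>

lemma place_infinite_eqI:
  fixes Q :: "'a::field poly fract set"
  assumes Q: "Q \<in> places constants UNIV" and x: "indet \<notin> place_ring UNIV Q"
  shows "Q = infinite_place"
proof -
  note U = is_subfield_UNIV
  note ring = is_subring_closed[OF place_ring_subring[OF Q U]]
  define y :: "'a poly fract" where "y = inverse indet"
  have y: "y \<in> Q" unfolding y_def using place_ring_not[OF Q U _ x] by simp
  have xy: "indet * y = 1" by (simp add: y_def indet_def)
  have cst: "cst c \<in> place_ring UNIV Q" for c
    using constants_in_place_ring[OF Q U] by (auto simp: constants_eq)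
  \<comment> \<open>Allowing d above the degree of p lets numerator and denominator be scaled by the
    same power of y.\<close>
  have leading: "emb p * y ^ d - cst (coeff p d) \<in> Q" if "degree p \<le> d" for p d
    using that
  proof (induction p arbitrary: d)
    case 0
    then show ?case using place_zero[OF Q U] by simp
  next
    case (pCons c p)
    have "emb (pCons c p) = emb ([:c:] + [:0, 1:] * p)" by simp
    then have emb: "emb (pCons c p) = cst c + indet * emb p"
      by (simp only: emb_simps cst_def indet_def)
    show ?case
    proof (cases d)
      case 0
      then have "p = 0" using pCons.prems by (auto split: if_splits)
      then show ?thesis using 0 emb place_zero[OF Q U] by simp
    next
      case (Suc e)
      then have "degree p \<le> e" using pCons.prems by (auto split: if_splits)
      then have "emb p * y ^ e - cst (coeff p e) \<in> Q" by (rule pCons.IH)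
      \<comment> \<open>As d = e + 1, the constant coefficient keeps at least one factor y and
        vanishes modulo Q.\<close>
      moreover have "y * (y ^ e * cst c) \<in> Q"
        using y place_subset_ring[OF Q U] by (intro place_mult[OF Q U] ring cst) auto
      ultimately have "y * (y ^ e * cst c) + (emb p * y ^ e - cst (coeff p e)) \<in> Q"
        by (intro place_add[OF Q U])
      also have "y * (y ^ e * cst c) + (emb p * y ^ e - cst (coeff p e)) =
          y * y ^ e * cst c + (indet * y) * (emb p * y ^ e) - cst (coeff p e)"
        by (simp add: xy)
      also have "\<dots> = emb (pCons c p) * y ^ d - cst (coeff (pCons c p) d)"
        unfolding emb Suc by (simp add: algebra_simps)
      finally show ?thesis .
    qed
  qed
  have in_ring: "emb p * y ^ d \<in> place_ring UNIV Q" if "degree p \<le> d" for p d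
    using ring(4)[OF subsetD[OF place_subset_ring[OF Q U] leading[OF that]] cst[of "coeff p d"]]
    by simp
  have in_Q: "emb p * y ^ d \<in> Q \<longleftrightarrow> coeff p d = 0" if "degree p \<le> d" for p d
  proof
    assume "emb p * y ^ d \<in> Q"
    then have "emb p * y ^ d - (emb p * y ^ d - cst (coeff p d)) \<in> Q"
      using place_diff[OF Q U] leading[OF that] by blast
    then show "coeff p d = 0" using cst_in_place_iff[OF Q] by simp
  qed (use leading[OF that] in simp)
  have inverse: "inverse (emb p * y ^ degree p) \<in> place_ring UNIV Q" if "p \<noteq> 0" for p
    using place_ring_inverse[OF Q U in_ring] in_Q[of p "degree p"] that by simp
  have y0: "y \<noteq> 0" by (simp add: y_def indet_def)
  show ?thesis
  proof (intro subset_antisym subsetI)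
    fix z :: "'a poly fract" assume "z \<in> infinite_place"
    then obtain p s where z: "z = emb p / emb s" "s \<noteq> 0" "p = 0 \<or> degree p < degree s"
      unfolding infinite_place_def by blast
    then have "emb p * y ^ degree s \<in> Q"
      using in_Q[of p "degree s"] by (auto simp: coeff_eq_0)
    then have "emb p * y ^ degree s * inverse (emb s * y ^ degree s) \<in> Q"
      using place_mult[OF Q U] inverse[OF z(2)] by blast
    moreover have "emb p * y ^ degree s * inverse (emb s * y ^ degree s) = z"
      using z(1,2) y0 by (simp add: field_simps)
    ultimately show "z \<in> Q" by simp
  next
    fix z assume "z \<in> Q"
    obtain p s where z: "s \<noteq> 0" "z = emb p / emb s" by (rule fract_coprime_cases)
    have "p = 0 \<or> degree p < degree s"
    proof (rule ccontr)
      assume "\<not> ?thesis"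
      then have p: "p \<noteq> 0" "degree s \<le> degree p" by auto
      have "emb s * y ^ degree p * inverse (emb p * y ^ degree p) \<in> place_ring UNIV Q"
        using ring(5) in_ring[OF p(2)] inverse[OF p(1)] by blast
      moreover have "emb s * y ^ degree p * inverse (emb p * y ^ degree p) = inverse z"
        unfolding z(2) using z(1) y0 p(1) by (simp add: field_simps)
      ultimately have "inverse z \<in> place_ring UNIV Q" by simp
      then have "z = 0" using place_inverse[OF Q U \<open>z \<in> Q\<close>] by blast
      then show False using z p by simp
    qed
    then show "z \<in> infinite_place" unfolding infinite_place_def using z by blast
  qed
qed

section \<open>The q + 1 rational places\<close>

lemma indet_minus_cst_in_finite_place: "indet - cst b \<in> finite_place a \<longleftrightarrow> a = b"
proof
  assume "a = b"
  have "indet - cst b = emb ([:0, 1:] - [:b:]) / emb 1"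
    by (simp only: emb_simps cst_def indet_def div_by_1)
  moreover have "poly ([:0, 1:] - [:b:]) b = 0" "poly 1 b \<noteq> 0" by simp_all
  ultimately show "indet - cst b \<in> finite_place a"
    unfolding finite_place_def \<open>a = b\<close> by blast
next
  note P = finite_place_place[of a] and U = is_subfield_UNIV
  assume b: "indet - cst b \<in> finite_place a"
  have "indet - cst a = emb ([:0, 1:] - [:a:]) / emb 1"
    by (simp only: emb_simps cst_def indet_def div_by_1)
  moreover have "poly ([:0, 1:] - [:a:]) a = 0" "poly 1 a \<noteq> 0" by simp_all
  ultimately have "indet - cst a \<in> finite_place a"
    unfolding finite_place_def by blast
  then have "indet - cst b - (indet - cst a) \<in> finite_place a" using place_diff[OF P U b] by blast
  then have "cst (a - b) \<in> finite_place a" by (simp add: algebra_simps)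
  then show "a = b" using cst_in_place_iff[OF P, of "a - b"] by simp
qed

lemma inverse_indet_in_infinite_place: "inverse indet \<in> infinite_place"
proof -
  have "inverse indet = emb 1 / emb ([:0, 1:] :: 'a poly)" by (simp add: indet_def inverse_eq_divide)
  moreover have "[:0, 1:] \<noteq> (0 :: 'a poly)" "degree (1 :: 'a poly) < degree ([:0, 1:] :: 'a poly)" by simp_all
  ultimately show ?thesis unfolding infinite_place_def by blast
qed

lemma indet_in_finite_place_ring: "indet \<in> place_ring UNIV (finite_place a)"
proof -
  note P = finite_place_place[of a] and U = is_subfield_UNIV
  have "indet - cst a \<in> place_ring UNIV (finite_place a)"
    using place_subset_ring[OF P U] indet_minus_cst_in_finite_place by blast
  moreover have "cst a \<in> place_ring UNIV (finite_place a)"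
    using constants_in_place_ring[OF P U] by (auto simp: constants_eq)
  ultimately have "indet - cst a + cst a \<in> place_ring UNIV (finite_place a)"
    using is_subring_closed(4)[OF place_ring_subring[OF P U]] by blast
  then show ?thesis by simp
qed

lemma finite_place_neq_infinite: "finite_place a \<noteq> infinite_place"
proof
  note P = finite_place_place[of a] and U = is_subfield_UNIV
  assume "finite_place a = infinite_place"
  then have "inverse indet \<in> finite_place a" using inverse_indet_in_infinite_place by simp
  then have "inverse indet * indet \<in> finite_place a"
    using place_mult[OF P U] indet_in_finite_place_ring by blast
  then show False using place_one[OF P U] by (simp add: indet_def)
qed

lemma inj_finite_place: "inj finite_place"
  by (rule injI) (metis indet_minus_cst_in_finite_place)

lemma finite_place_rational: "finite_place a \<in> rational_places constants UNIV"
proof (rule rational_placesI[OF finite_place_place is_subfield_UNIV is_subfield_constants])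
  note P = finite_place_place[of a] and U = is_subfield_UNIV
  fix z assume z: "z \<in> place_ring UNIV (finite_place a)"
  obtain u v where uv: "v \<noteq> 0" "coprime u v" "z = emb u / emb v" by (rule fract_coprime_cases)
  have "poly v a \<noteq> 0"
  proof
    assume v: "poly v a = 0"
    then have "poly u a \<noteq> 0" using coprime_poly_roots[of v u] uv(2) by (simp add: coprime_commute)
    then have "inverse z \<in> finite_place a" using v unfolding finite_place_def uv(3) inverse_divide by blast
    then have "inverse z * z \<in> finite_place a" using place_mult[OF P U] z by blast
    moreover have "z \<noteq> 0" using \<open>poly u a \<noteq> 0\<close> uv by auto
    ultimately show False using place_one[OF P U] by simp
  qed
  define c where "c = poly u a / poly v a"
  have "z - cst c = emb (u - [:c:] * v) / emb v"
    unfolding uv(3) emb_simps cst_def[symmetric] using uv(1) by (simp add: diff_divide_distrib)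
  moreover have "poly (u - [:c:] * v) a = 0" using \<open>poly v a \<noteq> 0\<close> by (simp add: c_def)
  ultimately have "z - cst c \<in> finite_place a"
    unfolding finite_place_def using \<open>poly v a \<noteq> 0\<close> by blast
  then show "\<exists>c\<in>constants. z - c \<in> finite_place a" by (auto simp: constants_eq)
qed

lemma infinite_place_rational: "infinite_place \<in> rational_places constants UNIV"
proof (rule rational_placesI[OF infinite_place_place is_subfield_UNIV is_subfield_constants])
  note P = infinite_place_place[where 'a = 'a] and U = is_subfield_UNIV
  fix z :: "'a poly fract" assume z: "z \<in> place_ring UNIV infinite_place"
  obtain u v where uv: "v \<noteq> 0" "coprime u v" "z = emb u / emb v" by (rule fract_coprime_cases)
  have deg: "degree u \<le> degree v"
  proof (rule ccontr)
    assume "\<not> degree u \<le> degree v"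
    moreover from this have "u \<noteq> 0" by auto
    ultimately have "inverse z \<in> infinite_place" unfolding infinite_place_def uv(3) inverse_divide by force
    then have "inverse z * z \<in> infinite_place" using place_mult[OF P U] z by blast
    then show False using place_one[OF P U] \<open>u \<noteq> 0\<close> uv by simp
  qed
  \<comment> \<open>The value of u/v at infinity. The coefficient of u is taken at the degree of v,
    so that it is 0 when u has smaller degree.\<close>
  define c where "c = coeff u (degree v) / lead_coeff v"
  have eq: "z - cst c = emb (u - [:c:] * v) / emb v"
    unfolding uv(3) emb_simps cst_def[symmetric] using uv(1) by (simp add: diff_divide_distrib)
  have "u - [:c:] * v = 0 \<or> degree (u - [:c:] * v) < degree v"
  proof (rule disjCI)
    assume "\<not> degree (u - [:c:] * v) < degree v"
    moreover have "degree (u - [:c:] * v) \<le> degree v"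
      using deg by (intro degree_diff_le) (auto intro: order.trans[OF degree_smult_le])
    moreover have "coeff (u - [:c:] * v) (degree v) = 0" using uv(1) by (simp add: c_def)
    ultimately have "lead_coeff (u - [:c:] * v) = 0" by (metis le_neq_implies_less)
    then show "u - [:c:] * v = 0" by (simp only: leading_coeff_0_iff)
  qed
  then have "z - cst c \<in> infinite_place"
    unfolding infinite_place_def eq using uv(1) by blast
  then show "\<exists>c\<in>constants. z - c \<in> infinite_place" by (auto simp: constants_eq)
qed

text \<open>At a rational place x either has a constant residue c, and then x - c lies in the place,
  or it has a pole.\<close>

lemma rational_places_eq: "rational_places constants UNIV = insert infinite_place (range finite_place)"
proof (intro subset_antisym subsetI)
  fix Q :: "'a poly fract set" assume "Q \<in> rational_places constants UNIV"
  note Q = rational_placesD[OF this is_subfield_UNIV is_subfield_constants]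
  show "Q \<in> insert infinite_place (range finite_place)"
  proof (cases "indet \<in> place_ring UNIV Q")
    case True
    then obtain c where "indet - cst c \<in> Q" using Q(2) by (auto simp: constants_eq)
    then show ?thesis using place_finite_eqI[OF Q(1)] by blast
  next
    case False
    then show ?thesis using place_infinite_eqI[OF Q(1)] by blast
  qed
qed (auto simp: finite_place_rational infinite_place_rational)

lemma card_rational_places:
  "finite (rational_places constants (UNIV :: 'a::{field,finite} poly fract set))"
  "card (rational_places constants (UNIV :: 'a poly fract set)) = CARD('a) + 1"
proof -
  have "infinite_place \<notin> range (finite_place :: 'a \<Rightarrow> _)"
    using finite_place_neq_infinite by (metis imageE)
  then show "finite (rational_places constants (UNIV :: 'a poly fract set))"
    "card (rational_places constants (UNIV :: 'a poly fract set)) = CARD('a) + 1"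
    unfolding rational_places_eq by (simp_all add: card_image inj_finite_place)
qed

section \<open>Counting the places above a rational place\<close>

text \<open>The polynomials in Q form an ideal of F_q[x], generated by a nonzero element of least
  degree. The generator is not constant because nonzero constants are units at Q.\<close>

lemma place_generator:
  fixes Q :: "'a::field poly fract set"
  assumes Q: "Q \<in> places constants UNIV" and x: "indet \<in> place_ring UNIV Q"
    and F: "F \<noteq> 0" "emb F \<in> Q"
  obtains p where "p \<noteq> 0" "0 < degree p" "\<And>u. emb u \<in> Q \<longleftrightarrow> p dvd u"
proof -
  note U = is_subfield_UNIV
  obtain p where p: "p \<noteq> 0" "emb p \<in> Q"
    and least: "\<And>u. u \<noteq> 0 \<Longrightarrow> emb u \<in> Q \<Longrightarrow> degree p \<le> degree u"
    using arg_min_nat_lemma[of "\<lambda>u. u \<noteq> 0 \<and> emb u \<in> Q" F degree] F by blast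
  have dvd: "p dvd u" if "emb u \<in> Q" for u
  proof (rule ccontr)
    assume "\<not> p dvd u"
    then have nz: "u mod p \<noteq> 0" by (simp add: dvd_eq_mod_eq_0)
    have "emb (u mod p) = emb u - emb p * emb (u div p)"
      by (metis emb_simps(4,5) minus_mult_div_eq_mod)
    then have "emb (u mod p) \<in> Q"
      using place_diff[OF Q U that place_mult[OF Q U p(2) emb_in_place_ring[OF Q x]]] by simp
    then have "degree p \<le> degree (u mod p)" using least nz by blast
    then show False using degree_mod_less[OF p(1), of u] nz by simp
  qed
  have in_Q: "emb u \<in> Q" if "p dvd u" for u
    using that place_mult[OF Q U p(2) emb_in_place_ring[OF Q x]] by (auto elim: dvdE)
  have "0 < degree p"
  proof (rule ccontr)
    assume "\<not> 0 < degree p"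
    then obtain c where "p = [:c:]" by (auto elim: degree_eq_zeroE)
    then show False using p cst_in_place_iff[OF Q, of c] by (simp add: cst_def)
  qed
  show thesis by (rule that[OF p(1) \<open>0 < degree p\<close>]) (use dvd in_Q in blast)
qed

text \<open>Distinct places have distinct prime generators, all dividing F, so their product divides
  F, and each contributes at least 1 to the degree. Equality leaves only linear generators, whose
  roots give the finite places.\<close>

lemma card_finite_places_le:
  fixes F :: "'a::field poly"
  assumes "finite S" and S: "S \<subseteq> places constants UNIV"
    and x: "\<And>Q. Q \<in> S \<Longrightarrow> indet \<in> place_ring UNIV Q"
    and F: "F \<noteq> 0" "\<And>Q. Q \<in> S \<Longrightarrow> emb F \<in> Q"
  shows "card S \<le> degree F"
    and "card S = degree F \<Longrightarrow> S \<subseteq> range finite_place"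
proof -
  note U = is_subfield_UNIV
  have "\<forall>Q\<in>S. \<exists>p. p \<noteq> 0 \<and> 0 < degree p \<and> (\<forall>u. emb u \<in> Q \<longleftrightarrow> p dvd u)"
  proof
    fix Q assume Q: "Q \<in> S"
    show "\<exists>p. p \<noteq> 0 \<and> 0 < degree p \<and> (\<forall>u. emb u \<in> Q \<longleftrightarrow> p dvd u)"
      by (rule place_generator[OF subsetD[OF S Q] x[OF Q] F(1) F(2)[OF Q]]) blast
  qed
  then obtain p where p: "\<And>Q. Q \<in> S \<Longrightarrow> p Q \<noteq> 0" "\<And>Q. Q \<in> S \<Longrightarrow> 0 < degree (p Q)"
    "\<And>Q u. Q \<in> S \<Longrightarrow> emb u \<in> Q \<longleftrightarrow> p Q dvd u"
    by metis
  have prime: "p Q dvd u \<or> p Q dvd v" if "Q \<in> S" "p Q dvd u * v" for Q u v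
  proof -
    note Q = subsetD[OF S that(1)] and x = x[OF that(1)]
    have "emb u * emb v \<in> Q" using p(3)[OF that(1), of "u * v"] that(2) by simp
    then have "emb u \<in> Q \<or> emb v \<in> Q"
      by (rule place_prime[OF Q U _ emb_in_place_ring[OF Q x] emb_in_place_ring[OF Q x]])
    then show ?thesis using p(3)[OF that(1)] by simp
  qed
  \<comment> \<open>Primality of p Q' turns one divisibility into two; the places then contain the
    same polynomials and coincide by \<open>place_eq_fractions\<close>.\<close>
  have distinct: "Q = Q'" if Q: "Q \<in> S" "Q' \<in> S" and dvd: "p Q dvd p Q'" for Q Q'
  proof -
    obtain v where v: "p Q' = p Q * v" using dvd by blast
    have "\<not> p Q' dvd v"
    proof
      assume "p Q' dvd v"
      then obtain v' where "v = p Q' * v'" by blast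
      then have "p Q' * 1 = p Q' * (p Q * v')" using v by (metis mult.left_commute mult_1_right)
      then have "1 = p Q * v'" using p(1)[OF Q(2)] by (metis mult_cancel_left)
      then have "is_unit (p Q)" by (metis dvd_triv_left)
      then show False using p(1,2)[OF Q(1)] by (simp add: is_unit_iff_degree)
    qed
    then have "p Q' dvd p Q" using prime[OF Q(2), of "p Q" v] v by simp
    then have eq: "emb u \<in> Q \<longleftrightarrow> emb u \<in> Q'" for u using p(3) Q dvd dvd_trans by blast
    show ?thesis
      using place_eq_fractions[of Q] place_eq_fractions[of Q'] Q S x unfolding eq by blast
  qed
  have prime_prod: "\<exists>Q'\<in>T. p Q dvd p Q'"
    if "finite T" "T \<subseteq> S" "Q \<in> S" "p Q dvd prod p T" for Q T
    using that
  proof (induction T)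
    case empty
    then show ?case using p(1,2)[of Q] by (simp add: is_unit_iff_degree)
  next
    case (insert Q' T)
    then have "p Q dvd p Q' \<or> p Q dvd prod p T" using prime[of Q "p Q'" "prod p T"] by simp
    then show ?case using insert by blast
  qed
  have prod_dvd: "prod p T dvd F" if "T \<subseteq> S" for T
  proof -
    have "finite T" using that \<open>finite S\<close> finite_subset by blast
    then show ?thesis using that
    proof (induction T)
      case (insert Q T)
      then obtain w where w: "F = prod p T * w" by blast
      have no: "\<not> p Q dvd prod p T"
      proof
        assume "p Q dvd prod p T"
        then have "\<exists>Q'\<in>T. p Q dvd p Q'" using prime_prod[of T Q] insert by blast
        then show False using distinct insert by blast
      qed
      have "p Q dvd F" using p(3) F(2) insert.prems by blast
      then have "p Q dvd w" using prime[of Q "prod p T" w] no w insert.prems by blast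
      then have "p Q * prod p T dvd F" unfolding w by (simp add: mult.commute mult_dvd_mono)
      then show ?case using insert.hyps by simp
    qed simp
  qed
  have "degree (prod p S) = (\<Sum>Q\<in>S. degree (p Q))"
    using p(1) by (intro degree_prod_eq_sum_degree) auto
  then have sum: "(\<Sum>Q\<in>S. degree (p Q)) \<le> degree F"
    using dvd_imp_degree_le[OF prod_dvd[OF subset_refl] F(1)] by simp
  have ge: "card S \<le> (\<Sum>Q\<in>S. degree (p Q))"
    using sum_mono[of S "\<lambda>_. 1" "\<lambda>Q. degree (p Q)"] p(2) by (simp add: Suc_leI)
  then show "card S \<le> degree F" using sum by simp
  assume "card S = degree F"
  then have eq: "(\<Sum>Q\<in>S. degree (p Q)) = (\<Sum>Q\<in>S. 1)" using sum ge by simp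
  have degree_1: "degree (p Q) = 1" if "Q \<in> S" for Q
  proof (rule ccontr)
    assume "degree (p Q) \<noteq> 1"
    then have "1 < degree (p Q)" using p(2)[OF that] by simp
    then have "(\<Sum>Q\<in>S. 1) < (\<Sum>Q\<in>S. degree (p Q))"
      using p(2) that \<open>finite S\<close> by (intro sum_strict_mono_ex1) (auto simp: Suc_le_eq intro!: bexI[of _ Q])
    then show False using eq by simp
  qed
  show "S \<subseteq> range finite_place"
  proof
    fix Q assume Q: "Q \<in> S"
    obtain b c where bc: "p Q = [:b, c:]" "c \<noteq> 0"
      using degree_1[OF Q] by (metis degree1_coeffs)
    have "[:0, 1:] - [:- b / c:] = smult (1 / c) (p Q)" using bc by simp
    then have "p Q dvd [:0, 1:] - [:- b / c:]" by (simp only: dvd_smult dvd_refl)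
    then have "emb ([:0, 1:] - [:- b / c:]) \<in> Q" using p(3)[OF Q] by blast
    then have "indet - cst (- b / c) \<in> Q" by (simp only: emb_simps cst_def indet_def)
    then show "Q \<in> range finite_place" using place_finite_eqI Q S by blast
  qed
qed

text \<open>Zeros of f/g at which x is integral are zeros of f and number at most deg f. Infinity is
  the only other candidate and is a zero only if deg f < deg g, so deg f \<le> n - 1 makes room for
  it. If there are n zeros, the finite ones number exactly deg f, which forces them to be
  rational.\<close>

lemma card_zeros_le:
  fixes f g :: "'a::field poly"
  assumes g: "g \<noteq> 0" and fg: "coprime f g" and n: "n = max (degree f) (degree g)" "0 < n"
  defines "S \<equiv> {Q \<in> places constants UNIV. emb f / emb g \<in> Q}"
  shows "finite S" "card S \<le> n" "card S = n \<Longrightarrow> S \<subseteq> rational_places constants UNIV"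
proof -
  note U = is_subfield_UNIV
  have "f \<noteq> 0"
  proof
    assume "f = 0"
    then have "degree g = 0" using fg g by (simp add: is_unit_iff_degree)
    then show False using n \<open>f = 0\<close> by simp
  qed
  have emb_f: "emb f \<in> Q" if "Q \<in> S" "indet \<in> place_ring UNIV Q" for Q
  proof -
    have "emb f / emb g * emb g \<in> Q"
      using that emb_in_place_ring by (intro place_mult[OF _ U]) (auto simp: S_def)
    then show ?thesis using g by simp
  qed
  have x: "indet \<in> place_ring UNIV Q" if "Q \<in> S - {infinite_place}" for Q
    using that place_infinite_eqI[of Q] unfolding S_def by blast
  have inf: "degree f < n" if "infinite_place \<in> S"
    using that emb_divide_in_infinite_place_iff[OF g] \<open>f \<noteq> 0\<close> n by (auto simp: S_def)
  have sub: "T - {infinite_place} \<subseteq> places constants UNIV" if "T \<subseteq> S" for T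
    using that by (auto simp: S_def)
  \<comment> \<open>The bound is stated for finite subsets because finiteness of S is itself deduced
    from the uniform bound on them.\<close>
  have T: "card (T - {infinite_place}) \<le> degree f"
    "card (T - {infinite_place}) = degree f \<Longrightarrow> T - {infinite_place} \<subseteq> range finite_place"
    if "T \<subseteq> S" "finite T" for T
    using card_finite_places_le[OF finite_Diff[OF that(2)] sub[OF that(1)] _ \<open>f \<noteq> 0\<close>] that x emb_f
    by blast+
  have le: "card T \<le> card (T - {infinite_place}) + (if infinite_place \<in> S then 1 else 0)"
    if "T \<subseteq> S" "finite T" for T
    using that by (auto simp: card_Diff_singleton_if)
  have "card T \<le> n" if "T \<subseteq> S" "finite T" for T
    using T(1)[OF that] le[OF that] inf n by (auto split: if_splits)
  then show "finite S" "card S \<le> n" using finite_if_finite_subsets_card_bdd by blast+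
  assume "card S = n"
  then have "card (S - {infinite_place}) = degree f"
    using T(1)[OF subset_refl \<open>finite S\<close>] le[OF subset_refl \<open>finite S\<close>] inf n
    by (auto split: if_splits)
  then show "S \<subseteq> rational_places constants UNIV"
    using T(2)[OF subset_refl \<open>finite S\<close>] unfolding rational_places_eq by blast
qed

text \<open>P contains h - a, where a is the residue of h, or 1/h if h has a pole. Either function
  has the same degree as h, and every place above P is one of its zeros.\<close>

lemma card_places_above_le:
  fixes h :: "'a::field poly fract"
  assumes n: "0 < rf_degree h" and P: "P \<in> rational_places constants (Fq_t h)"
  shows "finite (places_above constants UNIV P)"
    and "card (places_above constants UNIV P) \<le> rf_degree h"
    and "card (places_above constants UNIV P) = rf_degree h \<Longrightarrow>
      places_above constants UNIV P \<subseteq> rational_places constants UNIV"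
proof -
  let ?K = "Fq_t h"
  obtain f g where g: "g \<noteq> 0" and fg: "coprime f g" and h: "h = Fract f g"
    by (rule coprime_representation)
  have n': "rf_degree h = max (degree f) (degree g)" using rf_degree_Fract[OF g fg] h by simp
  have h': "h = emb f / emb g" using h g by (simp add: Fract_emb)
  note PD = rational_placesD[OF P Fq_t_subfield is_subfield_constants]
  have "\<exists>F G. G \<noteq> 0 \<and> coprime F G \<and> rf_degree h = max (degree F) (degree G) \<and> emb F / emb G \<in> P"
  proof (cases "h \<in> place_ring ?K P")
    case True
    then obtain a where a: "h - cst a \<in> P" using PD(2) by (auto simp: constants_eq)
    define F where "F = f - smult a g"
    have "emb F / emb g = h - cst a"
    proof -
      have "emb F = emb f - cst a * emb g"
        unfolding F_def emb_simps cst_def by (simp flip: emb_simps)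
      then show ?thesis using g by (simp add: h' field_simps)
    qed
    moreover have "coprime F g"
    proof (rule coprimeI)
      fix d assume d: "d dvd F" "d dvd g"
      then have "d dvd F + smult a g" by (intro dvd_add dvd_smult)
      then show "is_unit d" using d fg coprime_common_divisor by (auto simp: F_def)
    qed
    moreover have "rf_degree h = max (degree F) (degree g)"
    proof (cases "degree f \<le> degree g")
      case True
      then have "degree F \<le> degree g"
        unfolding F_def by (intro degree_diff_le) (auto intro: order.trans[OF degree_smult_le])
      then show ?thesis using True n' by simp
    next
      case False
      then have "degree (smult a g) < degree f" using degree_smult_le[of a g] by simp
      then have "degree F = degree f"
        unfolding F_def diff_conv_add_uminus by (intro degree_add_eq_left) simp
      then show ?thesis using n' by simp
    qed
    ultimately show ?thesis using a g by metis
  next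
    case False
    then have "inverse h \<in> P" using place_ring_not[OF PD(1) Fq_t_subfield in_Fq_t] by blast
    then have "emb g / emb f \<in> P" by (simp add: h')
    moreover have "h \<noteq> 0"
      using False is_subring_closed(1)[OF place_ring_subring[OF PD(1) Fq_t_subfield]] by auto
    then have "f \<noteq> 0" using h' by auto
    ultimately show ?thesis using fg n' by (metis coprime_commute max.commute)
  qed
  then obtain F G where FG: "G \<noteq> 0" "coprime F G" "rf_degree h = max (degree F) (degree G)"
    and w: "emb F / emb G \<in> P"
    by blast
  let ?S = "{Q \<in> places constants UNIV. emb F / emb G \<in> Q}"
  note S = card_zeros_le[OF FG n]
  have sub: "places_above constants UNIV P \<subseteq> ?S" using w by (auto simp: places_above_def)
  show "finite (places_above constants UNIV P)" using sub S(1) finite_subset by blast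
  show "card (places_above constants UNIV P) \<le> rf_degree h"
    using card_mono[OF S(1) sub] S(2) by simp
  assume eq: "card (places_above constants UNIV P) = rf_degree h"
  then have "card ?S = rf_degree h" using card_mono[OF S(1) sub] S(2) by simp
  then show "places_above constants UNIV P \<subseteq> rational_places constants UNIV"
    using S(3) sub by blast
qed

section \<open>The Galois group and the rational places\<close>

text \<open>The delicate part is strictness of both inclusions for the restricted ring, and there h
  must be nonconstant. The ring contains h or 1/h, so it exceeds the constants. If it were all of K,
  then h - c in Q would have an inverse integral at Q.\<close>

lemma place_restrict:
  fixes h :: "'a::field poly fract"
  assumes n: "0 < rf_degree h" and Q: "Q \<in> rational_places constants UNIV"
  shows "Q \<inter> Fq_t h \<in> rational_places constants (Fq_t h)"
proof -
  let ?K = "Fq_t h" and ?R = "place_ring UNIV Q"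
  note U = is_subfield_UNIV and C = is_subfield_constants
  note QD = rational_placesD[OF Q U C]
  note K = is_subfield_closed[OF Fq_t_subfield[of h]]
    and KR = is_subring_closed[OF is_subfield_closed(1)[OF Fq_t_subfield[of h]]]
  have h_notin: "h \<notin> constants" "inverse h \<notin> constants"
  proof -
    show *: "h \<notin> constants" using n by (auto simp: constants_eq)
    show "inverse h \<notin> constants"
      using * is_subfield_closed(2)[OF C, of "inverse h"] by auto
  qed
  have h_cases: "(\<exists>c\<in>constants. h - c \<in> Q) \<or> inverse h \<in> Q"
    using QD(2)[of h] place_ring_not[OF QD(1) U, of h] by blast
  have "is_subring (?R \<inter> ?K)"
    using place_ring_subring[OF QD(1) U] K(1) unfolding is_subring_def by blast
  moreover have "constants \<subset> ?R \<inter> ?K"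
  proof
    show "constants \<subseteq> ?R \<inter> ?K"
      using constants_in_place_ring[OF QD(1) U] constants_subset_Fq_t by blast
    have "h \<in> ?R \<or> inverse h \<in> ?R"
      using place_ring_not[OF QD(1) U, of h] place_subset_ring[OF QD(1) U] by blast
    then show "constants \<noteq> ?R \<inter> ?K" using h_notin K(2)[OF in_Fq_t] in_Fq_t[of h] by blast
  qed
  moreover have "?R \<inter> ?K \<subset> ?K"
  proof
    show "?R \<inter> ?K \<noteq> ?K"
    proof
      assume eq: "?R \<inter> ?K = ?K"
      then have h: "h \<in> ?R" using in_Fq_t[of h] by blast
      then obtain c where c: "c \<in> constants" "h - c \<in> Q" using QD(2) by blast
      have "inverse (h - c) \<in> ?K"
        using c(1) constants_subset_Fq_t in_Fq_t by (intro K(2) KR(3)) auto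
      then have "h - c = 0" using eq place_inverse[OF QD(1) U c(2)] by blast
      then show False using h_notin c by simp
    qed
  qed simp
  moreover have "\<forall>z\<in>?K. z \<noteq> 0 \<longrightarrow> z \<in> ?R \<inter> ?K \<or> inverse z \<in> ?R \<inter> ?K"
    using place_ring_not[OF QD(1) U] place_subset_ring[OF QD(1) U] K(2) by blast
  ultimately have val: "valuation_ring constants ?K (?R \<inter> ?K)" by (simp add: valuation_ring_def)
  have nonunits: "nonunits (?R \<inter> ?K) = Q \<inter> ?K"
  proof -
    have "Q = nonunits ?R" by (rule places_valuation_ring(2)[OF QD(1)])
    then have "z \<in> Q \<longleftrightarrow> z \<in> ?R \<and> (z = 0 \<or> inverse z \<notin> ?R)" for z
      unfolding nonunits_def by blast
    then show ?thesis unfolding nonunits_def using K(2) by blast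
  qed
  then have place: "Q \<inter> ?K \<in> places constants ?K" using val by (auto simp: places_def)
  show ?thesis
  proof (rule rational_placesI[OF place Fq_t_subfield C])
    fix z assume "z \<in> place_ring ?K (Q \<inter> ?K)"
    then have "z \<in> ?R \<inter> ?K" using place_ring_nonunits[OF val] nonunits by simp
    then show "\<exists>c\<in>constants. z - c \<in> Q \<inter> ?K"
      using QD(2)[of z] KR(3)[of z] constants_subset_Fq_t by blast
  qed
qed

text \<open>P is maximal in its ring. As P is rational, that ring is k + P and lies inside the ring
  of Q. Hence an element of K outside P has an inverse integral at Q and cannot lie in Q unless it
  is zero.\<close>

lemma place_above_restrict:
  assumes P: "P \<in> rational_places k K" and "is_subfield K" "is_subfield k"
    and Q: "Q \<in> places k UNIV" and "P \<subseteq> Q"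
  shows "Q \<inter> K = P"
proof (rule subset_antisym)
  note U = is_subfield_UNIV
  note PD = rational_placesD[OF P assms(2,3)]
  show "P \<subseteq> Q \<inter> K"
    using assms(5) place_subset_ring[OF PD(1) assms(2)] place_ring_subset[OF PD(1) assms(2)] by blast
  show "Q \<inter> K \<subseteq> P"
  proof (rule subsetI, rule ccontr)
    fix z assume z: "z \<in> Q \<inter> K" and "z \<notin> P"
    then have nz: "z \<noteq> 0" using place_zero[OF PD(1) assms(2)] by auto
    have "inverse z \<in> place_ring UNIV Q"
    proof (cases "z \<in> place_ring K P")
      case True
      then have "inverse z \<in> place_ring K P" using place_ring_inverse[OF PD(1) assms(2)] \<open>z \<notin> P\<close> by blast
      then obtain c where c: "c \<in> k" "inverse z - c \<in> P" using PD(2) by blast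
      then have "inverse z - c \<in> place_ring UNIV Q" "c \<in> place_ring UNIV Q"
        using assms(5) place_subset_ring[OF Q U] constants_in_place_ring[OF Q U] by blast+
      then have "inverse z - c + c \<in> place_ring UNIV Q"
        using is_subring_closed(4)[OF place_ring_subring[OF Q U]] by blast
      then show ?thesis by simp
    next
      case False
      then show ?thesis
        using place_ring_not[OF PD(1) assms(2)] z assms(5) place_subset_ring[OF Q U] by blast
    qed
    then show False using place_inverse[OF Q U] z nz by blast
  qed
qed

lemma field_aut_image_iff:
  assumes "\<sigma> \<in> field_auts K"
  shows "z \<in> \<sigma> ` Q \<longleftrightarrow> inv_into UNIV \<sigma> z \<in> Q" "\<sigma> z \<in> \<sigma> ` Q \<longleftrightarrow> z \<in> Q"
  using field_auts_inv[OF assms] by (metis image_iff)+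

lemma field_aut_place_image:
  assumes s: "\<sigma> \<in> field_auts K" "k \<subseteq> K" and U: "is_subfield k" and Q: "Q \<in> rational_places k UNIV"
  shows "\<sigma> ` Q \<in> rational_places k UNIV"
proof -
  let ?R = "place_ring UNIV Q"
  note QD = rational_placesD[OF Q is_subfield_UNIV U]
  note val = places_valuation_ring[OF QD(1)]
  note hom = field_autsD[OF s(1)] field_auts_hom[OF s(1)]
  have fixed: "\<sigma> c = c" if "c \<in> k" for c using that s hom(4) by blast
  have ring: "is_subring (\<sigma> ` ?R)"
    unfolding is_subring_def
  proof (intro conjI ballI)
    show "1 \<in> \<sigma> ` ?R"
      using is_subring_closed(2)[OF place_ring_subring[OF QD(1) is_subfield_UNIV]] hom(6) by (metis imageI)
    fix u v assume "u \<in> \<sigma> ` ?R" "v \<in> \<sigma> ` ?R"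
    then obtain u' v' where "u = \<sigma> u'" "v = \<sigma> v'" "u' \<in> ?R" "v' \<in> ?R" by blast
    then show "u - v \<in> \<sigma> ` ?R" "u * v \<in> \<sigma> ` ?R"
      using is_subring_closed(3,5)[OF place_ring_subring[OF QD(1) is_subfield_UNIV], of u' v']
      by (simp_all flip: hom(3,8))
  qed
  have inv: "\<sigma> (inverse u) = inverse (\<sigma> u)" for u by (rule field_auts_hom(5)[OF s(1)])
  have surj: "\<exists>u. z = \<sigma> u" for z using hom(1) by (meson bij_pointE)
  have "valuation_ring k UNIV (\<sigma> ` ?R)"
    unfolding valuation_ring_def
  proof (intro conjI ballI impI)
    show "k \<subset> \<sigma> ` ?R"
    proof
      have k: "k \<subset> ?R" using val(1) by (simp add: valuation_ring_def)
      then show "k \<subseteq> \<sigma> ` ?R" using fixed by (metis imageI psubsetD subsetI)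
      obtain z where "z \<in> ?R" "z \<notin> k" using k by blast
      have "\<sigma> z \<notin> k"
      proof
        assume "\<sigma> z \<in> k"
        then have "\<sigma> (\<sigma> z) = \<sigma> z" by (rule fixed)
        then have "\<sigma> z = z" by (rule injD[OF bij_is_inj[OF hom(1)]])
        then show False using \<open>\<sigma> z \<in> k\<close> \<open>z \<notin> k\<close> by simp
      qed
      moreover have "\<sigma> z \<in> \<sigma> ` ?R" using \<open>z \<in> ?R\<close> by (rule imageI)
      ultimately show "k \<noteq> \<sigma> ` ?R" by blast
    qed
    obtain z where "z \<notin> ?R" using val(1) by (auto simp: valuation_ring_def)
    then have "\<sigma> z \<notin> \<sigma> ` ?R" by (simp only: field_aut_image_iff(2)[OF s(1)] not_False_eq_True)
    then show "\<sigma> ` ?R \<subset> UNIV" by blast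
    fix z :: 'a assume "z \<noteq> 0"
    obtain u where u: "z = \<sigma> u" using surj by blast
    have "u \<in> ?R \<or> inverse u \<in> ?R"
      using place_ring_not[OF QD(1) is_subfield_UNIV, of u] place_subset_ring[OF QD(1) is_subfield_UNIV] by blast
    then show "z \<in> \<sigma> ` ?R \<or> inverse z \<in> \<sigma> ` ?R" unfolding u using inv by (metis imageI)
  qed (rule ring)
  moreover have eq: "nonunits (\<sigma> ` ?R) = \<sigma> ` Q"
  proof -
    have "\<sigma> u \<in> nonunits (\<sigma> ` ?R) \<longleftrightarrow> u \<in> nonunits ?R" for u
      unfolding nonunits_def mem_Collect_eq inv[symmetric] field_aut_image_iff(2)[OF s(1)]
      using field_auts_hom(7)[OF s(1)] by simp
    then have "\<sigma> u \<in> nonunits (\<sigma> ` ?R) \<longleftrightarrow> \<sigma> u \<in> \<sigma> ` Q" for u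
      using val(2) field_aut_image_iff(2)[OF s(1)] by metis
    then show ?thesis using surj by (metis Set.set_eqI)
  qed
  ultimately have place: "\<sigma> ` Q \<in> places k UNIV" and "place_ring UNIV (\<sigma> ` Q) = \<sigma> ` ?R"
    using place_ring_nonunits[of k UNIV "\<sigma> ` ?R"] by (auto simp: places_def intro!: exI[of _ "\<sigma> ` ?R"])
  show ?thesis
  proof (rule rational_placesI[OF place is_subfield_UNIV U])
    fix z assume "z \<in> place_ring UNIV (\<sigma> ` Q)"
    then obtain u where u: "z = \<sigma> u" "u \<in> ?R" using \<open>place_ring UNIV (\<sigma> ` Q) = \<sigma> ` ?R\<close> by blast
    then obtain c where c: "c \<in> k" "u - c \<in> Q" using QD(2) by blast
    then have "z - c \<in> \<sigma> ` Q" using u fixed field_auts_hom(4)[OF s(1)] by (metis imageI)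
    then show "\<exists>c\<in>k. z - c \<in> \<sigma> ` Q" using c by blast
  qed
qed

text \<open>A function with a single zero Q and a single pole Q' among the rational places: (x -
  a)/(x - b), or x - a, or 1/(x - b) if infinity is involved.\<close>

lemma separating_function:
  fixes Q Q' :: "'a::field poly fract set"
  assumes Q: "Q \<in> rational_places constants UNIV" "Q' \<in> rational_places constants UNIV" "Q \<noteq> Q'"
  obtains z where "z \<in> Q" "inverse z \<in> Q'"
    "\<And>R. R \<in> rational_places constants UNIV \<Longrightarrow> z \<in> R \<Longrightarrow> R = Q"
    "\<And>R. R \<in> rational_places constants UNIV \<Longrightarrow> inverse z \<in> R \<Longrightarrow> R = Q'"
proof -
  \<comment> \<open>The property is symmetric under exchanging the places and inverting z, which
    reduces the case Q = infinity to the case Q' = infinity.\<close>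
  define sep where "sep Q Q' z \<longleftrightarrow> z \<in> Q \<and> inverse z \<in> Q' \<and>
    (\<forall>R\<in>insert infinite_place (range finite_place). (z \<in> R \<longrightarrow> R = Q) \<and> (inverse z \<in> R \<longrightarrow> R = Q'))"
    for Q Q' and z :: "'a poly fract"
  have sep_sym: "sep Q' Q (inverse z)" if "sep Q Q' z" for Q Q' z
    using that unfolding sep_def inverse_inverse_eq by blast
  have finite_fr: "emb u / emb v \<in> finite_place c" if "poly u c = 0" "poly v c \<noteq> 0"
    for u v :: "'a poly" and c
    using that unfolding finite_place_def by blast
  have sep_fin: "sep (finite_place a) (finite_place b) (emb [:- a, 1:] / emb [:- b, 1:])"
    if "a \<noteq> b" for a b :: 'a
    unfolding sep_def inverse_divide
    using that emb_divide_in_finite_place[of "[:- b, 1:]" "[:- a, 1:]"]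
      emb_divide_in_finite_place[of "[:- a, 1:]" "[:- b, 1:]"]
    by (auto simp: emb_divide_in_infinite_place_iff intro!: finite_fr)
  have sep_inf: "sep (finite_place a) infinite_place (emb [:- a, 1:] / emb 1)" for a :: 'a
    unfolding sep_def inverse_divide
    using emb_divide_in_finite_place[of 1 "[:- a, 1:]"]
      emb_divide_in_finite_place[of "[:- a, 1:]" 1]
    by (auto simp: emb_divide_in_infinite_place_iff simp del: emb_simps(2) div_by_1 intro!: finite_fr)
  have "\<exists>z. sep Q Q' z"
  proof (cases "Q = infinite_place")
    case True
    then obtain b where "Q' = finite_place b" using Q unfolding rational_places_eq by blast
    then show ?thesis using True sep_sym[OF sep_inf] by blast
  next
    case False
    then obtain a where a: "Q = finite_place a" using Q unfolding rational_places_eq by blast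
    show ?thesis
    proof (cases "Q' = infinite_place")
      case True
      then show ?thesis using a sep_inf by blast
    next
      case False
      then obtain b where b: "Q' = finite_place b" using Q unfolding rational_places_eq by blast
      then have "a \<noteq> b" using a Q(3) by blast
      then show ?thesis unfolding a b using sep_fin by blast
    qed
  qed
  then obtain z where z: "sep Q Q' z" by blast
  show thesis
  proof (rule that)
    show "z \<in> Q" "inverse z \<in> Q'" using z by (simp_all add: sep_def)
    fix R :: "'a poly fract set" assume "R \<in> rational_places constants UNIV"
    then have "R \<in> insert infinite_place (range finite_place)" by (simp only: rational_places_eq)
    then show "z \<in> R \<Longrightarrow> R = Q" "inverse z \<in> R \<Longrightarrow> R = Q'" using z unfolding sep_def by blast+
  qed
qed

lemma place_ring_prod:
  assumes "is_subring R" "\<And>i. i \<in> I \<Longrightarrow> u i \<in> R"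
  shows "prod u I \<in> R"
  using assms(2)
  by (induction I rule: infinite_finite_induct) (auto intro: is_subring_closed[OF assms(1)])

lemma field_auts_prod:
  assumes "\<sigma> \<in> field_auts K"
  shows "\<sigma> (prod u I) = (\<Prod>i\<in>I. \<sigma> (u i))"
  by (induction I rule: infinite_finite_induct)
    (simp_all add: field_autsD(3)[OF assms] field_auts_hom(2)[OF assms])

text \<open>If \<open>Q'\<close> were not conjugate to \<open>Q\<close>, the norm of a function with its only zero at \<open>Q\<close>
  and its only pole at \<open>Q'\<close> would have a zero at \<open>Q\<close> and a pole at \<open>Q'\<close>, although it lies in \<open>K\<close>.\<close>

lemma galois_transitive:
  fixes Q Q' :: "'a::field poly fract set"
  assumes galois: "galois_extension K" and fin: "finite (field_auts K)" and K: "constants \<subseteq> K"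
    and Q: "Q \<in> rational_places constants UNIV" and Q': "Q' \<in> rational_places constants UNIV"
    and eq: "Q \<inter> K = Q' \<inter> K"
  shows "\<exists>\<sigma>\<in>field_auts K. \<sigma> ` Q = Q'"
proof (rule ccontr)
  note U = is_subfield_UNIV and C = is_subfield_constants
  let ?G = "field_auts K"
  assume "\<not> ?thesis"
  then have no: "\<sigma> ` Q \<noteq> Q'" if "\<sigma> \<in> ?G" for \<sigma> using that by blast
  have no': "\<sigma> ` Q' \<noteq> Q" if "\<sigma> \<in> ?G" for \<sigma>
  proof
    assume "\<sigma> ` Q' = Q"
    then have "inv_into UNIV \<sigma> ` Q = Q'"
      using field_autsD(1)[OF that] by (auto simp: bij_is_inj image_inv_f_f)
    then show False using no field_auts_inv(1)[OF that] by blast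
  qed
  have "Q \<noteq> Q'" using no[OF field_auts_id] by simp
  obtain z where z: "z \<in> Q" "inverse z \<in> Q'"
    and zQ: "\<And>R. R \<in> rational_places constants UNIV \<Longrightarrow> z \<in> R \<Longrightarrow> R = Q"
    and zQ': "\<And>R. R \<in> rational_places constants UNIV \<Longrightarrow> inverse z \<in> R \<Longrightarrow> R = Q'"
    by (rule separating_function[OF Q Q' \<open>Q \<noteq> Q'\<close>]) blast
  note QP = rational_placesD(1)[OF Q U C] and QP' = rational_placesD(1)[OF Q' U C]
  have preimage: "inv_into UNIV \<sigma> ` R \<in> rational_places constants UNIV \<and>
      (w \<in> inv_into UNIV \<sigma> ` R \<longleftrightarrow> \<sigma> w \<in> R)"
    if "\<sigma> \<in> ?G" "R \<in> rational_places constants UNIV" for \<sigma> R w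
  proof
    show "inv_into UNIV \<sigma> ` R \<in> rational_places constants UNIV"
      by (rule field_aut_place_image[OF field_auts_inv(1)[OF that(1)] K C that(2)])
    show "w \<in> inv_into UNIV \<sigma> ` R \<longleftrightarrow> \<sigma> w \<in> R"
      using field_aut_image_iff(2)[OF field_auts_inv(1)[OF that(1)], of "\<sigma> w"]
      by (simp add: field_auts_inv(3)[OF that(1)])
  qed
  \<comment> \<open>A pole of \<sigma>(z) at Q would be a pole of z at the preimage of Q under
    \<sigma>. That preimage would then be Q', against the assumption that Q and Q' are not
    conjugate.\<close>
  have zero: "\<sigma> z \<in> place_ring UNIV Q" if s: "\<sigma> \<in> ?G" for \<sigma>
  proof (rule ccontr)
    assume "\<sigma> z \<notin> place_ring UNIV Q"
    then have "\<sigma> (inverse z) \<in> Q"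
      using place_ring_not[OF QP U] field_auts_hom(5)[OF s] by simp
    then have "inv_into UNIV \<sigma> ` Q = Q'" using zQ' preimage[OF s Q] by blast
    then show False using no field_auts_inv(1)[OF s] by blast
  qed
  have pole: "\<sigma> (inverse z) \<in> place_ring UNIV Q'" if s: "\<sigma> \<in> ?G" for \<sigma>
  proof (rule ccontr)
    assume "\<sigma> (inverse z) \<notin> place_ring UNIV Q'"
    then have "\<sigma> z \<in> Q'"
      using place_ring_not[OF QP' U, of "\<sigma> (inverse z)"] field_auts_hom(5)[OF s] by simp
    then have "inv_into UNIV \<sigma> ` Q' = Q" using zQ preimage[OF s Q'] by blast
    then show False using no' field_auts_inv(1)[OF s] by blast
  qed
  have norm_K: "(\<Prod>\<tau>\<in>?G. \<tau> w) \<in> K" for w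
  proof -
    have "\<sigma> (\<Prod>\<tau>\<in>?G. \<tau> w) = (\<Prod>\<tau>\<in>?G. \<tau> w)" if s: "\<sigma> \<in> ?G" for \<sigma>
    proof -
      have "\<sigma> (\<Prod>\<tau>\<in>?G. \<tau> w) = (\<Prod>\<tau>\<in>?G. (\<sigma> \<circ> \<tau>) w)"
        by (simp add: field_auts_prod[OF s])
      also have "\<dots> = (\<Prod>\<tau>\<in>?G. \<tau> w)"
        by (rule prod.reindex_bij_betw[OF field_auts_comp_bij[OF s]])
      finally show ?thesis .
    qed
    then show ?thesis using galois unfolding galois_extension_def by blast
  qed
  have norm_place: "(\<Prod>\<tau>\<in>?G. \<tau> w) \<in> P"
    if P: "P \<in> places constants UNIV" "w \<in> P" "\<And>\<sigma>. \<sigma> \<in> ?G \<Longrightarrow> \<sigma> w \<in> place_ring UNIV P" for w P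
  proof -
    have "(\<Prod>\<tau>\<in>?G. \<tau> w) = id w * (\<Prod>\<tau>\<in>?G - {id}. \<tau> w)"
      by (rule prod.remove[OF fin field_auts_id])
    moreover have "(\<Prod>\<tau>\<in>?G - {id}. \<tau> w) \<in> place_ring UNIV P"
      using P(3) by (intro place_ring_prod place_ring_subring[OF P(1) U]) blast
    ultimately show ?thesis using place_mult[OF P(1) U P(2)] by simp
  qed
  let ?N = "\<Prod>\<tau>\<in>?G. \<tau> z"
  have "?N \<in> Q" by (rule norm_place[OF QP z(1)]) (rule zero)
  have "(\<Prod>\<tau>\<in>?G. \<tau> (inverse z)) \<in> Q'" by (rule norm_place[OF QP' z(2)]) (rule pole)
  \<comment> \<open>The norm of 1/z lies in K, where Q and Q' agree; so the norm of z and its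
    inverse both end up in Q.\<close>
  then have "(\<Prod>\<tau>\<in>?G. \<tau> (inverse z)) \<in> Q" using norm_K eq by blast
  moreover have "(\<Prod>\<tau>\<in>?G. \<tau> (inverse z)) = inverse ?N"
    unfolding prod_inversef[symmetric] comp_def
    by (intro prod.cong refl) (rule field_auts_hom(5))
  ultimately have "inverse ?N \<in> place_ring UNIV Q" using place_subset_ring[OF QP U] by auto
  \<comment> \<open>Since \<open>inverse 0 = 0\<close>, a vanishing norm has to be excluded
    separately: it forces z = 0, which lies in Q' although Q is the only rational zero of z.\<close>
  then have "?N = 0" using place_inverse[OF QP U \<open>?N \<in> Q\<close>] by blast
  then obtain \<tau> where "\<tau> \<in> ?G" "\<tau> z = 0" using fin by (auto simp: prod_zero_iff)
  then have "z = 0" using field_auts_hom(7) by blast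
  then have "z \<in> Q'" using place_zero[OF QP' U] by simp
  then show False using zQ[OF Q'] \<open>Q \<noteq> Q'\<close> by simp
qed

text \<open>A rational place \<open>x = a\<close> is fixed by \<open>x \<mapsto> A/B\<close> only if \<open>a\<close> is a root of \<open>A - xB\<close>.\<close>

lemma card_fixed_places_le:
  fixes \<sigma> :: "'a::field poly fract \<Rightarrow> 'a poly fract"
  assumes s: "\<sigma> \<in> field_auts K" and K: "constants \<subseteq> K" and "\<sigma> \<noteq> id"
  shows "card {Q \<in> rational_places constants UNIV. \<sigma> ` Q = Q} \<le> 2" (is "card ?F \<le> 2")
proof -
  obtain A B where AB: "coprime A B" "B \<noteq> 0" "degree A \<le> 1" "degree B \<le> 1"
    and x: "\<sigma> indet = emb A / emb B"
    by (rule aut_indet_mobius[OF s K])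
  define D where "D = A - [:0, 1:] * B"
  have "D \<noteq> 0"
  proof
    assume "D = 0"
    then have "emb A = indet * emb B" unfolding D_def by (simp add: indet_def flip: emb_simps(5))
    then have "\<sigma> indet = id indet" using AB x by simp
    then show False using field_auts_eqI[OF s field_auts_id K] \<open>\<sigma> \<noteq> id\<close> by blast
  qed
  have fixed_cst: "\<sigma> (cst a) = cst a" for a
    using field_autsD(4)[OF s] K by (auto simp: constants_eq)
  have finite: "poly D a = 0" if "\<sigma> ` finite_place a = finite_place a" for a
  proof -
    have "\<sigma> (indet - cst a) \<in> finite_place a"
      using that indet_minus_cst_in_finite_place[of a a] by blast
    also have "\<sigma> (indet - cst a) = \<sigma> indet - cst a"
      by (simp only: field_auts_hom(4)[OF s] fixed_cst)
    also have "\<dots> = emb (A - [:a:] * B) / emb B"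
      unfolding x emb_simps cst_def[symmetric] using AB(2) by (simp add: diff_divide_distrib)
    finally have "poly (A - [:a:] * B) a = 0" by (rule emb_divide_in_finite_place[OF AB(2)])
    then show ?thesis by (simp add: D_def)
  qed
  \<comment> \<open>If infinity is fixed then B is constant and D is at most linear; the lost root
    pays for the extra fixed place, and the total stays at 2.\<close>
  have infinite: "degree D \<le> 1" if "\<sigma> ` infinite_place = infinite_place"
  proof -
    have "\<sigma> (inverse indet) \<in> infinite_place"
      using that inverse_indet_in_infinite_place by blast
    then have in_inf: "emb B / emb A \<in> infinite_place"
      by (simp add: field_auts_hom(5)[OF s] x)
    have "A \<noteq> 0"
    proof
      assume "A = 0"
      then have "(indet :: 'a poly fract) = 0" using x field_auts_hom(7)[OF s, of indet] by simp
      then show False by (simp add: indet_def)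
    qed
    then have "degree B = 0" using in_inf AB emb_divide_in_infinite_place_iff by force
    then have "degree ([:0, 1:] * B) \<le> 1" using degree_mult_le[of "[:0, 1:]" B] by simp
    then show ?thesis unfolding D_def using AB(3) by (intro degree_diff_le)
  qed
  have "degree D \<le> 2"
    unfolding D_def using AB(3,4) degree_mult_le[of "[:0, 1:]" B] by (intro degree_diff_le) auto
  let ?Z = "finite_place ` {a. poly D a = 0}"
  have Z: "finite ?Z" "card ?Z \<le> degree D"
    using poly_roots_finite[OF \<open>D \<noteq> 0\<close>] card_poly_roots_bound[OF \<open>D \<noteq> 0\<close>]
    by (auto intro: order.trans[OF card_image_le])
  have sub: "?F \<subseteq> insert infinite_place ?Z"
    using finite unfolding rational_places_eq by blast
  show ?thesis
  proof (cases "infinite_place \<in> ?F")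
    case True
    then have "degree D \<le> 1" using infinite by blast
    moreover have "card ?F \<le> card (insert infinite_place ?Z)"
      using sub Z(1) by (intro card_mono) auto
    ultimately show ?thesis using Z card_insert_le_m1[of 2 ?Z infinite_place] by simp
  next
    case False
    then have "?F \<subseteq> ?Z" using sub by blast
    then have "card ?F \<le> card ?Z" by (rule card_mono[OF Z(1)])
    then show ?thesis using Z(2) \<open>degree D \<le> 2\<close> by linarith
  qed
qed

section \<open>The action on rational places and its orbits\<close>

definition place_action :: "('a::field poly fract \<Rightarrow> 'a poly fract) \<Rightarrow> 'a poly fract set \<Rightarrow> 'a poly fract set" where
  "place_action \<sigma> = (\<lambda>P\<in>rational_places constants UNIV. \<sigma> ` P)"

lemma carrier_G_h: "carrier (G_h h) = field_auts (Fq_t h)"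
  by (simp add: G_h_def galois_group_def)

lemma group_action_G_h:
  fixes h :: "'a::field poly fract"
  shows "group_action (G_h h) (rational_places constants UNIV) place_action"
proof -
  let ?E = "rational_places constants (UNIV :: 'a poly fract set)"
  have image: "\<sigma> ` P \<in> ?E" if "\<sigma> \<in> field_auts (Fq_t h)" "P \<in> ?E" for \<sigma> P
    by (rule field_aut_place_image[OF that(1) constants_subset_Fq_t is_subfield_constants that(2)])
  \<comment> \<open>\<open>Bij\<close> consists of extensional maps, which is why
    \<open>place_action\<close> restricts the image map to the rational places. The orbits agree
    with those of the unrestricted map by \<open>place_orbits_eq_orbits\<close>.\<close>
  have bij: "place_action \<sigma> \<in> Bij ?E" if s: "\<sigma> \<in> field_auts (Fq_t h)" for \<sigma>
  proof -
    have "bij_betw (\<lambda>P. \<sigma> ` P) ?E ?E"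
    proof (rule bij_betw_byWitness[where f' = "\<lambda>P. inv_into UNIV \<sigma> ` P"])
      show "\<forall>P\<in>?E. inv_into UNIV \<sigma> ` \<sigma> ` P = P" "\<forall>P\<in>?E. \<sigma> ` inv_into UNIV \<sigma> ` P = P"
        by (simp_all add: image_image field_auts_inv(2,3)[OF s])
      show "(\<lambda>P. \<sigma> ` P) ` ?E \<subseteq> ?E" "(\<lambda>P. inv_into UNIV \<sigma> ` P) ` ?E \<subseteq> ?E"
        using image[OF s] image[OF field_auts_inv(1)[OF s]] by blast+
    qed
    then show ?thesis by (simp add: Bij_def place_action_def)
  qed
  have "place_action \<in> hom (G_h h) (BijGroup ?E)"
  proof (rule homI)
    fix \<sigma> \<tau> assume "\<sigma> \<in> carrier (G_h h)" "\<tau> \<in> carrier (G_h h)"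
    then have st: "\<sigma> \<in> field_auts (Fq_t h)" "\<tau> \<in> field_auts (Fq_t h)" by (simp_all add: carrier_G_h)
    have "place_action (\<sigma> \<circ> \<tau>) = compose ?E (place_action \<sigma>) (place_action \<tau>)"
      using image[OF st(2)] by (auto simp: place_action_def compose_def fun_eq_iff image_comp)
    then show "place_action (\<sigma> \<otimes>\<^bsub>G_h h\<^esub> \<tau>) = place_action \<sigma> \<otimes>\<^bsub>BijGroup ?E\<^esub> place_action \<tau>"
      using bij[OF st(1)] bij[OF st(2)] by (simp add: BijGroup_def G_h_def galois_group_def)
  qed (simp add: BijGroup_def bij carrier_G_h)
  then show ?thesis
    using group_galois_group[of "Fq_t h"] group_BijGroup[of ?E]
    by (simp add: group_action_def group_hom_def group_hom_axioms_def G_h_def)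
qed

lemma orbit_place_action:
  assumes "Q \<in> rational_places constants UNIV"
  shows "orbit (G_h h) place_action Q = (\<lambda>\<sigma>. \<sigma> ` Q) ` field_auts (Fq_t h)"
  using assms by (auto simp: orbit_def place_action_def carrier_G_h)

lemma place_orbits_eq_image:
  "place_orbits h = (\<lambda>Q. (\<lambda>\<sigma>. \<sigma> ` Q) ` field_auts (Fq_t h)) ` rational_places constants UNIV"
  by (auto simp: place_orbits_def orbits_def orbit_def carrier_G_h)

lemma place_orbits_eq_orbits:
  "place_orbits h = orbits (G_h h) (rational_places constants UNIV) place_action"
  unfolding place_orbits_eq_image orbits_def Setcompr_eq_image
  by (intro image_cong refl) (simp add: orbit_place_action)

lemma order_G_h:
  assumes "0 < rf_degree h" "galois_extension (Fq_t h)"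
  shows "order (G_h h) = rf_degree h"
  using card_field_auts_Fq_t[OF assms] by (simp add: order_def carrier_G_h)

lemma orbit_subset_places_above:
  assumes Q: "Q \<in> rational_places constants UNIV" and P: "P \<subseteq> Q" "P \<subseteq> Fq_t h"
  shows "(\<lambda>\<sigma>. \<sigma> ` Q) ` field_auts (Fq_t h) \<subseteq> places_above constants UNIV P"
proof clarify
  fix \<sigma> assume s: "\<sigma> \<in> field_auts (Fq_t h)"
  have "P \<subseteq> \<sigma> ` Q"
  proof
    fix z assume "z \<in> P"
    then have "\<sigma> z = z" "z \<in> Q" using P field_autsD(4)[OF s] by blast+
    then show "z \<in> \<sigma> ` Q" by (metis imageI)
  qed
  moreover have "\<sigma> ` Q \<in> rational_places constants UNIV"
    by (rule field_aut_place_image[OF s constants_subset_Fq_t is_subfield_constants Q])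
  ultimately show "\<sigma> ` Q \<in> places_above constants UNIV P"
    by (simp add: places_above_def rational_places_def)
qed

text \<open>The inverse sends the orbit of Q to the restriction of Q to K. An orbit of n places
  exhausts the at most n places above that restriction, so the latter splits totally. Conversely,
  the n places above a split place are rational and restrict to the same place, hence form one
  orbit.\<close>

lemma T1_split_bij_long_orbits:
  fixes h :: "'a::field poly fract"
  assumes n: "0 < rf_degree h" and galois: "galois_extension (Fq_t h)"
  shows "bij_betw (places_above constants UNIV) (T1_split h)
    {X \<in> place_orbits h. card X = rf_degree h}"
proof -
  let ?K = "Fq_t h" and ?G = "field_auts (Fq_t h)"
  note U = is_subfield_UNIV and C = is_subfield_constants and K = Fq_t_subfield[of h]
  have fin: "finite ?G" and card: "card ?G = rf_degree h"
    using field_auts_Fq_t_card(1)[OF n] card_field_auts_Fq_t[OF n galois] .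
  have above: "Q \<in> places constants UNIV" "P \<subseteq> Q" if "Q \<in> places_above constants UNIV P" for P Q
    using that by (simp_all add: places_above_def)
  have split: "\<exists>Q\<in>rational_places constants UNIV. P \<subseteq> Q \<and> Q \<inter> ?K = P \<and>
      places_above constants UNIV P = (\<lambda>\<sigma>. \<sigma> ` Q) ` ?G" if P: "P \<in> T1_split h" for P
  proof -
    have rat: "P \<in> rational_places constants ?K"
      and eq: "card (places_above constants UNIV P) = rf_degree h"
      using P by (simp_all add: T1_split_def)
    have sub: "places_above constants UNIV P \<subseteq> rational_places constants UNIV"
      by (rule card_places_above_le(3)[OF n rat eq])
    obtain Q where Q: "Q \<in> places_above constants UNIV P"
      using eq n by (metis card.empty ex_in_conv less_irrefl)
    have restrict: "R \<inter> ?K = P" if "R \<in> places_above constants UNIV P" for R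
      by (rule place_above_restrict[OF rat K C above[OF that]])
    have "places_above constants UNIV P = (\<lambda>\<sigma>. \<sigma> ` Q) ` ?G"
    proof (rule subset_antisym)
      show "places_above constants UNIV P \<subseteq> (\<lambda>\<sigma>. \<sigma> ` Q) ` ?G"
      proof
        fix R assume R: "R \<in> places_above constants UNIV P"
        have "\<exists>\<sigma>\<in>?G. \<sigma> ` Q = R"
          using sub Q R restrict
          by (intro galois_transitive[OF galois fin constants_subset_Fq_t]) auto
        then show "R \<in> (\<lambda>\<sigma>. \<sigma> ` Q) ` ?G" by blast
      qed
      show "(\<lambda>\<sigma>. \<sigma> ` Q) ` ?G \<subseteq> places_above constants UNIV P"
        using sub Q above(2)[OF Q] restrict[OF Q] by (intro orbit_subset_places_above) auto
    qed
    then show ?thesis using above(2)[OF Q] restrict[OF Q] subsetD[OF sub Q] by (intro bexI[of _ Q] conjI)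
  qed
  have "inj_on (places_above constants UNIV) (T1_split h)"
  proof (rule inj_onI)
    fix P P' assume P: "P \<in> T1_split h" "P' \<in> T1_split h"
      and eq: "places_above constants UNIV P = places_above constants UNIV P'"
    obtain Q where Q: "Q \<in> rational_places constants UNIV" "P \<subseteq> Q" "Q \<inter> ?K = P"
      using split[OF P(1)] by blast
    then have "Q \<in> places_above constants UNIV P"
      by (simp add: places_above_def rational_places_def)
    then have Q': "Q \<in> places_above constants UNIV P'" using eq by simp
    have "Q \<inter> ?K = P'"
      using P(2) place_above_restrict[OF _ K C above[OF Q']] by (simp add: T1_split_def)
    then show "P = P'" using Q(3) by simp
  qed
  moreover have "places_above constants UNIV ` T1_split h =
      {X \<in> place_orbits h. card X = rf_degree h}" (is "?L = ?R")
  proof (rule subset_antisym)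
    show "?L \<subseteq> ?R"
    proof clarify
      fix P assume P: "P \<in> T1_split h"
      obtain Q where "Q \<in> rational_places constants UNIV"
        "places_above constants UNIV P = (\<lambda>\<sigma>. \<sigma> ` Q) ` ?G"
        using split[OF P] by blast
      then show "places_above constants UNIV P \<in> place_orbits h \<and>
          card (places_above constants UNIV P) = rf_degree h"
        using P unfolding place_orbits_eq_image T1_split_def by blast
    qed
    show "?R \<subseteq> ?L"
    proof clarify
      fix X assume X: "X \<in> place_orbits h" "card X = rf_degree h"
      then obtain Q where Q: "Q \<in> rational_places constants UNIV" and XQ: "X = (\<lambda>\<sigma>. \<sigma> ` Q) ` ?G"
        unfolding place_orbits_eq_image by blast
      have rat: "Q \<inter> ?K \<in> rational_places constants ?K" by (rule place_restrict[OF n Q])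
      note le = card_places_above_le[OF n rat]
      have "X \<subseteq> places_above constants UNIV (Q \<inter> ?K)"
        unfolding XQ using Q by (intro orbit_subset_places_above) auto
      then have eq: "X = places_above constants UNIV (Q \<inter> ?K)"
        using card_subset_eq[OF le(1)] card_mono[OF le(1)] le(2) X(2) by (metis le_antisym)
      then have "Q \<inter> ?K \<in> T1_split h" using rat X(2) by (simp add: T1_split_def)
      then show "X \<in> ?L" using eq by blast
    qed
  qed
  ultimately show ?thesis by (simp add: bij_betw_def)
qed

lemma card_place_orbits_le:
  fixes h :: "'a::{field,finite} poly fract"
  assumes n: "0 < rf_degree h" and galois: "galois_extension (Fq_t h)"
  shows "card (place_orbits h) * rf_degree h \<le> CARD('a) + 1 + 2 * (rf_degree h - 1)"
proof -
  let ?E = "rational_places constants (UNIV :: 'a poly fract set)" and ?G = "field_auts (Fq_t h)"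
  note E = card_rational_places[where 'a = 'a]
  have fin: "finite ?G" and card: "card ?G = rf_degree h"
    using field_auts_Fq_t_card(1)[OF n] card_field_auts_Fq_t[OF n galois] .
  have inv: "invariants ?E place_action \<sigma> = {Q \<in> ?E. \<sigma> ` Q = Q}" for \<sigma>
    by (auto simp: invariants_def place_action_def)
  have "card (place_orbits h) * rf_degree h = (\<Sum>\<sigma>\<in>?G. card {Q \<in> ?E. \<sigma> ` Q = Q})"
    using group_action.burnside[OF group_action_G_h[of h] _ E(1)] fin
    by (simp add: carrier_G_h order_G_h[OF n galois] place_orbits_eq_orbits inv)
  also have "\<dots> = card {Q \<in> ?E. id ` Q = Q} + (\<Sum>\<sigma>\<in>?G - {id}. card {Q \<in> ?E. \<sigma> ` Q = Q})"
    by (rule sum.remove[OF fin field_auts_id])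
  also have "card {Q \<in> ?E. id ` Q = Q} = CARD('a) + 1" using E(2) by simp
  also have "(\<Sum>\<sigma>\<in>?G - {id}. card {Q \<in> ?E. \<sigma> ` Q = Q}) \<le> (\<Sum>\<sigma>\<in>?G - {id}. 2)"
    using card_fixed_places_le[OF _ constants_subset_Fq_t] by (intro sum_mono) auto
  also have "(\<Sum>\<sigma>\<in>?G - {id}. 2) = 2 * (rf_degree h - 1)"
    using card field_auts_id[of "Fq_t h"] by (simp add: card_Diff_singleton)
  finally show ?thesis by simp
qed

lemma place_orbits_partition:
  fixes h :: "'a::{field,finite} poly fract"
  assumes n: "0 < rf_degree h" and galois: "galois_extension (Fq_t h)"
  shows "finite (place_orbits h)"
    and "(\<Sum>X\<in>place_orbits h. card X) = CARD('a) + 1"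
    and "X \<in> place_orbits h \<Longrightarrow> 0 < card X"
    and "X \<in> place_orbits h \<Longrightarrow> card X dvd rf_degree h"
proof -
  let ?E = "rational_places constants (UNIV :: 'a poly fract set)"
  note E = card_rational_places[where 'a = 'a]
  show "finite (place_orbits h)" unfolding place_orbits_eq_image using E(1) by blast
  have "(\<Sum>X\<in>place_orbits h. \<Sum>Q\<in>X. 1) = (\<Sum>Q\<in>?E. 1 :: nat)"
    unfolding place_orbits_eq_orbits by (rule group_action.disjoint_sum[OF group_action_G_h E(1)])
  then show "(\<Sum>X\<in>place_orbits h. card X) = CARD('a) + 1" using E(2) by simp
  assume "X \<in> place_orbits h"
  then obtain Q where Q: "Q \<in> ?E" "X = orbit (G_h h) place_action Q"
    unfolding place_orbits_eq_orbits orbits_def by blast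
  have "card X * card (stabilizer (G_h h) place_action Q) = rf_degree h"
    unfolding Q(2) using group_action.orbit_stabilizer_theorem[OF group_action_G_h Q(1)]
    by (simp add: order_G_h[OF n galois])
  then show "card X dvd rf_degree h" "0 < card X" using n by (metis dvd_triv_left, metis mult_is_0 neq0_conv)
qed

section \<open>From the orbit count to the ceiling formula\<close>

lemma ceiling_divide_eq:
  fixes m n k :: nat
  assumes "k * n < m" "m \<le> (k + 1) * n"
  shows "\<lceil>real m / real n\<rceil> = int k + 1"
proof -
  have "0 < n" using assms by (cases n) auto
  have "real (k * n) < real m" "real m \<le> real ((k + 1) * n)"
    using assms by (simp_all only: of_nat_less_iff of_nat_le_iff)
  then have "real k < real m / real n" "real m / real n \<le> real k + 1"
    using \<open>0 < n\<close> by (simp_all add: field_simps)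
  then show ?thesis by (intro ceiling_unique) simp_all
qed

theorem corollary5p2:
  fixes h :: "'a::{field,finite} poly fract" and q r :: nat
  assumes "q = CARD('a)"
    and "rf_degree h = r + 1"
    and "galois_extension (Fq_t h)"
  shows "(V_s h = 0 \<longrightarrow>
           real (card (T1_split h)) = (real q + 1) / (real r + 1)) \<and>
         (V_s h = 1 \<or> V_s h = 2 \<longrightarrow>
           int (card (T1_split h)) = \<lceil>(real q + 1) / (real r + 1)\<rceil> - 1) \<and>
         (V_s h = 3 \<longrightarrow>
           int (card (T1_split h)) = \<lceil>(real q + 1) / (real r + 1)\<rceil> - 2)"
proof -
  define n where "n = rf_degree h"
  define L where "L = card (T1_split h)"
  define S where "S = (\<Sum>X\<in>short_orbits h. card X)"
  have n: "0 < rf_degree h" "n = r + 1" using assms(2) by (simp_all add: n_def)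
  note orbits = place_orbits_partition[OF n(1) assms(3)]
  let ?long = "{X \<in> place_orbits h. card X = n}"
  have short: "short_orbits h = {X \<in> place_orbits h. card X \<noteq> n}"
    by (simp add: short_orbits_def order_G_h[OF n(1) assms(3)] n_def)
  have fin: "finite ?long" "finite (short_orbits h)"
    unfolding short using orbits(1) by simp_all
  have union: "place_orbits h = ?long \<union> short_orbits h" "?long \<inter> short_orbits h = {}"
    unfolding short by auto
  have L: "card ?long = L"
    using bij_betw_same_card[OF T1_split_bij_long_orbits[OF n(1) assms(3)]] by (simp add: n_def L_def)
  have V: "card (short_orbits h) = V_s h" by (simp add: V_s_def)
  have sum: "q + 1 = L * n + S"
    using orbits(2) sum.union_disjoint[OF fin union(2), of card] unfolding union(1)[symmetric]
    by (simp add: L S_def assms(1))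
  have "card (place_orbits h) = L + V_s h"
    using card_Un_disjoint[OF fin union(2)] unfolding union(1)[symmetric] L V .
  then have "(L + V_s h) * n \<le> q + 1 + 2 * (n - 1)"
    using card_place_orbits_le[OF n(1) assms(3)] by (simp add: n_def assms(1))
  \<comment> \<open>The L long orbits contribute L n to both sides and cancel.\<close>
  then have lower: "V_s h * n \<le> S + 2 * (n - 1)" using sum by (simp add: algebra_simps)
  have "card X * 2 \<le> n \<and> 0 < card X" if X: "X \<in> short_orbits h" for X
  proof -
    \<comment> \<open>The size of a short orbit is a proper divisor of n, which is where the factor
      1/2 comes from.\<close>
    obtain k where k: "n = card X * k" using orbits(4)[of X] X unfolding short n_def by blast
    have "k \<noteq> 0" using k n(2) by (intro notI) simp
    moreover have "k \<noteq> 1" using k X unfolding short by auto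
    ultimately have "2 \<le> k" by linarith
    then have "card X * 2 \<le> card X * k" by (intro mult_left_mono) simp_all
    then show ?thesis using k orbits(3)[of X] X unfolding short by simp
  qed
  then have upper: "S * 2 \<le> V_s h * n" and pos: "V_s h \<le> S"
    using sum_bounded_above[of "short_orbits h" "\<lambda>X. card X * 2" n]
      sum_bounded_below[of "short_orbits h" 1 card]
    by (simp_all add: S_def V sum_distrib_right Suc_le_eq)
  have frac: "(real q + 1) / (real r + 1) = real (q + 1) / real n" using n by (simp add: add.commute)
  have "real L = real (q + 1) / real n" if "V_s h = 0"
  proof -
    have "S = 0" using that upper by simp
    then show ?thesis using sum n by (simp add: field_simps flip: of_nat_mult)
  qed
  \<comment> \<open>Here 1 \<le> S \<le> n: there is at least one short orbit, and there are at most
    two, each of size at most n/2.\<close>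
  moreover have "\<lceil>real (q + 1) / real n\<rceil> = int L + 1" if "V_s h = 1 \<or> V_s h = 2"
    using that upper pos sum by (intro ceiling_divide_eq) (auto simp: algebra_simps)
  \<comment> \<open>Here n < S \<le> 2n: the lower bound reads S \<ge> 3n - 2(n - 1) = n + 2, and
    the upper one S \<le> 3n/2.\<close>
  moreover have "\<lceil>real (q + 1) / real n\<rceil> = int (L + 1) + 1" if "V_s h = 3"
    using that upper lower sum n by (intro ceiling_divide_eq) (auto simp: algebra_simps)
  ultimately show ?thesis unfolding frac L_def[symmetric] by auto
qed

end
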